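(* There exists a transcendental entire function of finite order whose Julia set has an isolated Julia limiting direction, i.e. $L(f)$ has an isolated point. Moreover, one can take $$f(z)=z-\frac{1-\exp(-z)}{z(z^2+4\pi^2)},$$ and for this entire function $$L(f)=\Big[\frac{\pi}{2},\frac{3\pi}{2}\Big]\cup\{0\}.$$
   Context: The displayed $f$ has removable singularities at $0,\pm 2\pi i$ and is regarded as an entire function. For a transcendental entire $f$, the Fatou set $\mathcal{F}(f)$ is the set of points having a neighborhood in which the iterates $f^n$ ($n\ge 1$) form a normal family; the Julia set $\mathcal{J}(f)$ is its complement. A value $\theta\in[0,2\pi)$ is a Julia limiting direction of $f$ if there is an unbounded sequence $\{z_n\}\subset\mathcal{J}(f)$ with $\lim_{n\to\infty}\arg z_n=\theta$. $L(f)$ denotes the set of all Julia limiting directions of $f$. The two endpoints of $[0,2\pi)$ are identified, so that $[0,2\pi)$ is a compact set (a circle), and arguments are taken modulo $2\pi$. The order of $f$ is $\rho(f)=\limsup_{r\to\infty}\frac{\log^+T(r,f)}{\log r}$, with $T(r,f)$ the Nevanlinna characteristic and $\log^+x=\max\{\log x,0\}$. *)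

theory Defs
  imports "HOL-Complex_Analysis.Complex_Analysis"
begin

definition transcendental_entire :: "(complex \<Rightarrow> complex) \<Rightarrow> bool" where
  "transcendental_entire f \<longleftrightarrow>
     f holomorphic_on UNIV \<and> \<not> (\<exists>p. \<forall>z. f z = poly p z)"

subsection \<open>Order of growth\<close>

text \<open>
  The value at \<open>0\<close> is \<open>0\<close>, since \<open>ln 0 = 0\<close>.
\<close>
definition log_plus :: "real \<Rightarrow> real" where
  "log_plus x = max (ln x) 0"

definition proximity_fun :: "real \<Rightarrow> (complex \<Rightarrow> complex) \<Rightarrow> real" where
  "proximity_fun r f =
     1 / (2 * pi) * integral {0..2 * pi} (\<lambda>t. log_plus (norm (f (of_real r * cis t))))"

text \<open>
  Poles are counted with multiplicity; \<open>zorder\<close> is negative at a pole.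
\<close>
definition pole_count :: "real \<Rightarrow> (complex \<Rightarrow> complex) \<Rightarrow> nat" where
  "pole_count r f = (\<Sum>z\<in>{z \<in> cball 0 r. is_pole f z}. nat (- zorder f z))"

definition counting_fun :: "real \<Rightarrow> (complex \<Rightarrow> complex) \<Rightarrow> real" where
  "counting_fun r f =
     integral {0..r} (\<lambda>t. (real (pole_count t f) - real (pole_count 0 f)) / t)
       + real (pole_count 0 f) * ln r"

definition nevanlinna_char :: "real \<Rightarrow> (complex \<Rightarrow> complex) \<Rightarrow> real" where
  "nevanlinna_char r f = proximity_fun r f + counting_fun r f"

definition growth_order :: "(complex \<Rightarrow> complex) \<Rightarrow> ereal" where
  "growth_order f =
     Limsup at_top (\<lambda>r::real. ereal (log_plus (nevanlinna_char r f) / ln r))"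

subsection \<open>Fatou and Julia sets\<close>

text \<open>
  Normality is meant in the spherical sense. For holomorphic functions on a domain, a
  locally uniform spherical limit is either finite everywhere or identically \<open>\<infinity>\<close>, which
  gives the two alternatives below. They need \<open>U\<close> to be connected.
\<close>
definition normal_family_on :: "complex set \<Rightarrow> (complex \<Rightarrow> complex) set \<Rightarrow> bool" where
  "normal_family_on U \<F> \<longleftrightarrow>
     (\<forall>s :: nat \<Rightarrow> complex \<Rightarrow> complex. range s \<subseteq> \<F> \<longrightarrow>
       (\<exists>r :: nat \<Rightarrow> nat. strict_mono r \<and>
         ((\<exists>g. \<forall>K. compact K \<and> K \<subseteq> U \<longrightarrow>
             uniform_limit K (\<lambda>n. s (r n)) g sequentially) \<or>
          (\<forall>K. compact K \<and> K \<subseteq> U \<longrightarrow>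
             (\<forall>B. \<forall>\<^sub>F n in sequentially. \<forall>z\<in>K. B < norm (s (r n) z))))))"

definition fatou_set :: "(complex \<Rightarrow> complex) \<Rightarrow> complex set" where
  "fatou_set f = {z. \<exists>U. open U \<and> connected U \<and> z \<in> U \<and>
     normal_family_on U {f ^^ n | n. n \<ge> 1}}"

definition julia_set :: "(complex \<Rightarrow> complex) \<Rightarrow> complex set" where
  "julia_set f = - fatou_set f"

subsection \<open>Julia limiting directions\<close>

text \<open>
  Convergence of arguments modulo \<open>2\<pi>\<close>: some choice of arguments converges to \<open>\<theta>\<close>.
  The point \<open>0\<close> is excluded because it has no argument.
\<close>
definition julia_limiting_directions :: "(complex \<Rightarrow> complex) \<Rightarrow> real set" where
  "julia_limiting_directions f = {\<theta> \<in> {0..<2 * pi}.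
     \<exists>z :: nat \<Rightarrow> complex. range z \<subseteq> julia_set f - {0} \<and> \<not> bounded (range z) \<and>
       (\<exists>\<phi> :: nat \<Rightarrow> real. (\<forall>n. is_Arg (z n) (\<phi> n)) \<and> \<phi> \<longlonglongrightarrow> \<theta>)}"

text \<open>
  The topology on \<open>[0, 2\<pi>)\<close> is that of the circle, carried over by \<open>cis\<close>.
\<close>
definition isolated_julia_limiting_direction :: "(complex \<Rightarrow> complex) \<Rightarrow> real \<Rightarrow> bool" where
  "isolated_julia_limiting_direction f \<theta> \<longleftrightarrow>
     \<theta> \<in> julia_limiting_directions f \<and>
     cis \<theta> isolated_in (cis ` julia_limiting_directions f)"

end

theory Submission
  imports Defs "HOL-Real_Asymp.Real_Asymp"
begin

text \<open>
  Far out in a cone of the right half-plane the map is \<open>z - 1 / z ^ 3\<close> up to smaller terms, so in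
  the coordinate \<open>w = z ^ 4\<close> it is nearly the translation \<open>w - 4\<close>. Each of the open
  quadrants adjacent to the positive real axis corresponds to the \<open>w\<close>-plane slit along the positive
  axis. Sectors opening to the left in that plane are invariant and escape uniformly
  (\<open>petal_subset_fatou\<close>), so they lie in the Fatou set, and no direction in
  \<open>(0, \<pi> / 2)\<close> or \<open>(3 \<pi> / 2, 2 \<pi>)\<close> is limiting.

  In the left half-plane \<open>exp (- z)\<close> dominates. The points \<open>2 \<pi> \<i> k\<close> with \<open>\<bar>k\<bar> \<ge> 2\<close> are repelling
  fixed points, which gives the two imaginary directions. In every direction of the open left
  half-plane the map takes some value \<open>2 \<pi> \<i> k\<close> within bounded distance of each point far enough
  out on the ray (\<open>preimage_of_fixed_point\<close>), and preimages of Julia points are Julia points.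

  The positive real axis separates two petals. If all directions near \<open>0\<close> were free of Julia points, a
  Fatou disc would contain both a large real point and a point of a petal. Petal orbits escape at most
  linearly, whereas real orbits run to the left and then at least double in each step. As both
  escape, Harnack's inequality for the logarithms of the moduli of the iterates
  (\<open>harnack_norm_le_cube\<close>) makes the two rates comparable, a contradiction. Hence \<open>0\<close> is a limiting direction
  (\<open>zero_limiting_direction\<close>); the others lie in the closed left half-plane, so it is isolated.
\<close>

section \<open>Normality, Fatou and Julia sets\<close>

lemma holomorphic_on_funpow:
  assumes "f holomorphic_on UNIV"
  shows "(f ^^ n) holomorphic_on S"
proof -
  have "(f ^^ n) holomorphic_on UNIV"
  proof (induction n)
    case (Suc n)
    have "(f \<circ> (f ^^ n)) holomorphic_on UNIV"
      using Suc assms by (intro holomorphic_on_compose_gen[where t=UNIV]) auto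
    then show ?case by (simp add: o_def)
  qed (simp add: id_def)
  then show ?thesis using holomorphic_on_subset by blast
qed

text \<open>
  This dichotomy is what normality of a family of iterates is checked against: a sequence of
  iterates has a subsequence that repeats a single iterate or one whose indices tend to infinity.
\<close>
lemma nat_sequence_constant_or_diverging_subsequence:
  fixes k :: "nat \<Rightarrow> nat"
  obtains r :: "nat \<Rightarrow> nat" where "strict_mono r" "\<exists>m. \<forall>n. k (r n) = m"
    | r :: "nat \<Rightarrow> nat" where "strict_mono r" "filterlim (k \<circ> r) at_top sequentially"
proof (cases "finite (range k)")
  case True
  obtain m where "infinite {n. k n = m}"
    using pigeonhole_infinite[OF infinite_UNIV_nat, of k] True by auto
  then have "\<exists>r::nat\<Rightarrow>nat. strict_mono r \<and> (\<forall>n. r n \<in> {n. k n = m})"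
    by (rule infinite_enumerate)
  then obtain r :: "nat \<Rightarrow> nat" where "strict_mono r" "\<forall>n. k (r n) = m" by blast
  then show ?thesis using that(1) by blast
next
  case False
  have "\<exists>n>m. k n \<ge> b" for m b
  proof (rule ccontr)
    assume "\<not> (\<exists>n>m. k n \<ge> b)"
    then have "k n \<le> b" if "\<not> n \<le> m" for n using that by (meson nat_le_linear not_le)
    then have "range k \<subseteq> k ` {..m} \<union> {..b}" by blast
    then show False using False finite_subset by blast
  qed
  then have "\<exists>r. \<forall>n. k (r n) \<ge> n \<and> r (Suc n) > r n"
    by (intro dependent_nat_choice) auto
  then obtain r where r: "\<And>n. k (r n) \<ge> n" "\<And>n. r (Suc n) > r n" by blast
  have "filterlim (k \<circ> r) at_top sequentially"
    using r(1) by (intro filterlim_at_top_mono[OF filterlim_ident]) (auto simp: o_def)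
  then show ?thesis using that(2)[of r] r(2) by (simp add: strict_mono_Suc_iff)
qed

text \<open>
  A lower bound that tends to infinity and is uniform on \<open>U\<close> gives normality at once, without
  Montel's theorem: along diverging indices the iterates tend to infinity uniformly, and along a
  repeated index they converge trivially. Discs around the points of \<open>U\<close> supply the connected
  neighbourhoods.
\<close>
lemma uniformly_escaping_domain_subset_fatou:
  assumes "open U"
    and "filterlim a at_top sequentially"
    and lower: "\<And>n z. z \<in> U \<Longrightarrow> a n \<le> norm ((f ^^ n) z)"
  shows "U \<subseteq> fatou_set f"
proof
  fix z assume "z \<in> U"
  then obtain e where e: "e > 0" "ball z e \<subseteq> U"
    using \<open>open U\<close> openE by blast
  have "normal_family_on (ball z e) {f ^^ n | n. n \<ge> 1}"
    unfolding normal_family_on_def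
  proof (intro allI impI)
    fix s :: "nat \<Rightarrow> complex \<Rightarrow> complex" assume "range s \<subseteq> {f ^^ n | n. n \<ge> 1}"
    then have "\<forall>j. \<exists>n. s j = f ^^ n" by blast
    then obtain k where k: "\<And>j. s j = f ^^ k j" by metis
    show "\<exists>r. strict_mono r \<and>
         ((\<exists>g. \<forall>K. compact K \<and> K \<subseteq> ball z e \<longrightarrow>
             uniform_limit K (\<lambda>n. s (r n)) g sequentially) \<or>
          (\<forall>K. compact K \<and> K \<subseteq> ball z e \<longrightarrow>
             (\<forall>B. \<forall>\<^sub>F n in sequentially. \<forall>z\<in>K. B < norm (s (r n) z))))"
    proof (rule nat_sequence_constant_or_diverging_subsequence[of k])
      fix r :: "nat \<Rightarrow> nat" assume r: "strict_mono r" "\<exists>m. \<forall>n. k (r n) = m"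
      then obtain m where "\<And>n. s (r n) = f ^^ m" using k by auto
      then have "\<forall>K. compact K \<and> K \<subseteq> ball z e \<longrightarrow>
             uniform_limit K (\<lambda>n. s (r n)) (f ^^ m) sequentially"
        by (auto intro!: uniform_limit_const)
      then show ?thesis using r(1) by blast
    next
      fix r :: "nat \<Rightarrow> nat" assume r: "strict_mono r" "filterlim (k \<circ> r) at_top sequentially"
      have "\<forall>\<^sub>F n in sequentially. \<forall>z\<in>K. B < norm (s (r n) z)" if "K \<subseteq> ball z e" for K B
      proof -
        have "filterlim (\<lambda>n. a ((k \<circ> r) n)) at_top sequentially"
          using filterlim_compose[OF assms(2) r(2)] .
        then have "\<forall>\<^sub>F n in sequentially. a ((k \<circ> r) n) > B"
          unfolding filterlim_at_top_dense by blast
        then show ?thesis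
        proof eventually_elim
          case (elim n)
          show ?case
          proof
            fix y assume "y \<in> K"
            then have "y \<in> U" using that e by blast
            then show "B < norm (s (r n) y)"
              using lower[of y "k (r n)"] elim by (simp add: k)
          qed
        qed
      qed
      then show ?thesis using r(1) by blast
    qed
  qed
  then show "z \<in> fatou_set f"
    unfolding fatou_set_def using e(1)
    by (intro CollectI exI[of _ "ball z e"]) auto
qed

text \<open>
  A nonconstant \<open>f\<close> is open, so the image of a small disc about \<open>z\<close> is a neighbourhood of \<open>f z\<close>.
  Convergence of \<open>f ^^ (n + 1)\<close> on the closed disc is convergence of \<open>f ^^ n\<close> on the image of
  that disc. The contrapositive is used below: preimages of Julia points are Julia points.
\<close>
lemma image_fatou_subset_fatou:
  assumes holf: "f holomorphic_on UNIV" and nonconst: "\<not> f constant_on UNIV"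
    and "z \<in> fatou_set f"
  shows "f z \<in> fatou_set f"
proof -
  obtain U where U: "open U" "z \<in> U" "normal_family_on U {f ^^ n | n. n \<ge> 1}"
    using assms(3) unfolding fatou_set_def by blast
  obtain e where e: "e > 0" "cball z e \<subseteq> U"
    using U open_contains_cball by blast
  have "open (f ` ball z e)"
    using open_mapping_thm[OF holf open_UNIV connected_UNIV open_ball _ nonconst] by auto
  moreover have "connected (f ` ball z e)"
    using holf by (intro connected_continuous_image connected_ball holomorphic_on_imp_continuous_on)
      (auto intro: holomorphic_on_subset)
  moreover have "normal_family_on (f ` ball z e) {f ^^ n | n. n \<ge> 1}"
    unfolding normal_family_on_def
  proof (intro allI impI)
    fix s :: "nat \<Rightarrow> complex \<Rightarrow> complex" assume s: "range s \<subseteq> {f ^^ n | n. n \<ge> 1}"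
    have "range (\<lambda>n. s n \<circ> f) \<subseteq> {f ^^ n | n. n \<ge> 1}"
    proof clarify
      fix n
      obtain m where "s n = f ^^ m" using s by blast
      then show "\<exists>m. s n \<circ> f = f ^^ m \<and> 1 \<le> m"
        by (intro exI[of _ "Suc m"]) (simp add: funpow_Suc_right del: funpow.simps)
    qed
    then obtain r where r: "strict_mono r" and
      lim: "(\<exists>g. \<forall>K. compact K \<and> K \<subseteq> U \<longrightarrow>
             uniform_limit K (\<lambda>n. s (r n) \<circ> f) g sequentially) \<or>
          (\<forall>K. compact K \<and> K \<subseteq> U \<longrightarrow>
             (\<forall>B. \<forall>\<^sub>F n in sequentially. \<forall>z\<in>K. B < norm ((s (r n) \<circ> f) z)))"
      using U(3)[unfolded normal_family_on_def, rule_format, of "\<lambda>n. s n \<circ> f"] by blast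
    show "\<exists>r. strict_mono r \<and>
         ((\<exists>g. \<forall>K. compact K \<and> K \<subseteq> f ` ball z e \<longrightarrow>
             uniform_limit K (\<lambda>n. s (r n)) g sequentially) \<or>
          (\<forall>K. compact K \<and> K \<subseteq> f ` ball z e \<longrightarrow>
             (\<forall>B. \<forall>\<^sub>F n in sequentially. \<forall>z\<in>K. B < norm (s (r n) z))))"
      using lim
    proof
      assume "\<exists>g. \<forall>K. compact K \<and> K \<subseteq> U \<longrightarrow>
             uniform_limit K (\<lambda>n. s (r n) \<circ> f) g sequentially"
      then obtain g where g: "uniform_limit (cball z e) (\<lambda>n. s (r n) \<circ> f) g sequentially"
        using e by (meson compact_cball)
      define h where "h = (\<lambda>w. g (inv_into (cball z e) f w))"
      have "uniform_limit (f ` cball z e) (\<lambda>n. s (r n)) h sequentially"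
        unfolding uniform_limit_iff
      proof (intro allI impI)
        fix \<epsilon> :: real assume "\<epsilon> > 0"
        then have "\<forall>\<^sub>F n in sequentially. \<forall>x\<in>cball z e. dist ((s (r n) \<circ> f) x) (g x) < \<epsilon>"
          using g unfolding uniform_limit_iff by blast
        then show "\<forall>\<^sub>F n in sequentially. \<forall>w\<in>f ` cball z e. dist (s (r n) w) (h w) < \<epsilon>"
        proof eventually_elim
          case (elim n)
          show ?case
          proof
            fix w assume w: "w \<in> f ` cball z e"
            show "dist (s (r n) w) (h w) < \<epsilon>"
              using elim[rule_format, OF inv_into_into[OF w]] f_inv_into_f[OF w]
              by (simp add: h_def)
          qed
        qed
      qed
      then have "uniform_limit K (\<lambda>n. s (r n)) h sequentially" if "K \<subseteq> f ` ball z e" for K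
        by (rule uniform_limit_on_subset) (use that in force)
      then show ?thesis using r by blast
    next
      assume inf: "\<forall>K. compact K \<and> K \<subseteq> U \<longrightarrow>
             (\<forall>B. \<forall>\<^sub>F n in sequentially. \<forall>z\<in>K. B < norm ((s (r n) \<circ> f) z))"
      have "\<forall>\<^sub>F n in sequentially. \<forall>w\<in>K. B < norm (s (r n) w)" if "K \<subseteq> f ` ball z e" for K B
      proof -
        have "\<forall>\<^sub>F n in sequentially. \<forall>x\<in>cball z e. B < norm ((s (r n) \<circ> f) x)"
          using inf e by (meson compact_cball)
        then show ?thesis
        proof eventually_elim
          case (elim n)
          then show ?case using that by fastforce
        qed
      qed
      then show ?thesis using r by blast
    qed
  qed
  ultimately show ?thesis
    unfolding fatou_set_def using e(1)
    by (intro CollectI exI[of _ "f ` ball z e"]) auto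
qed

text \<open>
  At \<open>p\<close> the derivative of \<open>f ^^ n\<close> is the \<open>n\<close>-th power of the multiplier, which is
  unbounded. Divergence to infinity is excluded by \<open>(f ^^ n) p = p\<close>, and uniform convergence
  near \<open>p\<close> would bound these derivatives by Cauchy's inequality.
\<close>
lemma repelling_fixed_point_in_julia:
  assumes holf: "f holomorphic_on UNIV" and fixed: "f p = p" and repelling: "norm (deriv f p) > 1"
  shows "p \<in> julia_set f"
proof (rule ccontr)
  assume "p \<notin> julia_set f"
  then obtain U where U: "open U" "p \<in> U" "normal_family_on U {f ^^ n | n. n \<ge> 1}"
    unfolding julia_set_def fatou_set_def by blast
  obtain e where e: "e > 0" "cball p e \<subseteq> U"
    using U open_contains_cball by blast
  have iter_fixed: "(f ^^ n) p = p" for n by (induction n) (auto simp: fixed)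
  have iter_deriv: "deriv (f ^^ n) p = deriv f p ^ n" for n
  proof (induction n)
    case (Suc n)
    have "deriv (f \<circ> (f ^^ n)) p = deriv f ((f ^^ n) p) * deriv (f ^^ n) p"
      by (rule deriv_chain; rule holomorphic_on_imp_differentiable_at[OF _ open_UNIV])
         (auto intro: holf holomorphic_on_funpow)
    then show ?case using Suc by (simp add: iter_fixed o_def)
  qed (simp add: id_def)
  define s where "s = (\<lambda>n. f ^^ Suc n)"
  have "range s \<subseteq> {f ^^ n | n. n \<ge> 1}" unfolding s_def by force
  then obtain r where r: "strict_mono r" and
      lim: "(\<exists>g. \<forall>K. compact K \<and> K \<subseteq> U \<longrightarrow>
             uniform_limit K (\<lambda>n. s (r n)) g sequentially) \<or>
          (\<forall>K. compact K \<and> K \<subseteq> U \<longrightarrow>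
             (\<forall>B. \<forall>\<^sub>F n in sequentially. \<forall>z\<in>K. B < norm (s (r n) z)))"
    using U(3) unfolding normal_family_on_def by blast
  have "\<not> (\<forall>\<^sub>F n in sequentially. \<forall>z\<in>{p}. norm p < norm (s (r n) z))"
    unfolding s_def using iter_fixed by (auto simp: eventually_sequentially simp del: funpow.simps)
  then have "\<not> (\<forall>K. compact K \<and> K \<subseteq> U \<longrightarrow>
             (\<forall>B. \<forall>\<^sub>F n in sequentially. \<forall>z\<in>K. B < norm (s (r n) z)))"
    using U(2) by (metis compact_sing empty_subsetI insert_subset)
  then obtain g where "uniform_limit (cball p e) (\<lambda>n. s (r n)) g sequentially"
    using lim e(2) by (meson compact_cball)
  then have "\<forall>\<^sub>F n in sequentially. \<forall>z\<in>cball p e. dist (s (r n) z) (g z) < 1"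
    unfolding uniform_limit_iff by (meson zero_less_one)
  then obtain N where N: "\<And>n z. n \<ge> N \<Longrightarrow> z \<in> cball p e \<Longrightarrow> dist (s (r n) z) (g z) < 1"
    unfolding eventually_sequentially by blast
  have hols: "s n holomorphic_on S" for n S
    unfolding s_def by (rule holomorphic_on_funpow[OF holf])
  have "compact (s (r N) ` cball p e)"
    by (intro compact_continuous_image holomorphic_on_imp_continuous_on hols compact_cball)
  then have "bounded (s (r N) ` cball p e)" by (rule compact_imp_bounded)
  then obtain B where B: "\<And>z. z \<in> cball p e \<Longrightarrow> norm (s (r N) z) \<le> B"
    unfolding bounded_iff by (metis imageI)
  have bound: "norm (deriv f p) ^ Suc (r n) \<le> (B + 2) / e" if "n \<ge> N" for n
  proof -
    have "norm ((deriv ^^ 1) (s (r n)) p) \<le> fact 1 * (B + 2) / e ^ 1"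
    proof (rule Cauchy_inequality)
      fix x assume "norm (p - x) = e"
      then have x: "x \<in> cball p e" by (simp add: dist_norm)
      have "dist (s (r n) x) (g x) < 1" "dist (s (r N) x) (g x) < 1"
        using N x that by auto
      then have "dist (s (r n) x) (s (r N) x) < 2"
        using dist_triangle2[of "s (r n) x" "s (r N) x" "g x"] by linarith
      then show "norm (s (r n) x) \<le> B + 2"
        using B[OF x] norm_triangle_sub[of "s (r n) x" "s (r N) x"] by (simp add: dist_norm)
    qed (auto intro: hols holomorphic_on_imp_continuous_on e)
    moreover have "deriv (s (r n)) p = deriv f p ^ Suc (r n)"
      unfolding s_def by (rule iter_deriv)
    ultimately show ?thesis by (simp add: norm_power norm_mult)
  qed
  obtain m where m: "norm (deriv f p) ^ m > (B + 2) / e"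
    using real_arch_pow[OF repelling] by blast
  define n where "n = max m N"
  have "m \<le> Suc (r n)" using seq_suble[OF r, of n] unfolding n_def by linarith
  then have "norm (deriv f p) ^ m \<le> norm (deriv f p) ^ Suc (r n)"
    using repelling by (intro power_increasing) auto
  also have "\<dots> \<le> (B + 2) / e" by (rule bound) (simp add: n_def)
  finally show False using m by simp
qed

text \<open>
  One escaping orbit rules out finite limit functions, so every sequence of iterates on \<open>U\<close> has
  a subsequence tending to infinity locally uniformly. Hence the whole sequence does.
\<close>
lemma normal_escape_uniform:
  assumes normal: "normal_family_on U {f ^^ n | n. n \<ge> 1}"
    and w: "w \<in> U" "filterlim (\<lambda>n. (f ^^ n) w) at_infinity sequentially"
    and K: "compact K" "K \<subseteq> U"
  shows "\<forall>\<^sub>F n in sequentially. \<forall>z\<in>K. B < norm ((f ^^ n) z)"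
proof (rule ccontr)
  assume "\<not> ?thesis"
  then have "\<exists>\<^sub>F n in sequentially. \<not> (\<forall>z\<in>K. B < norm ((f ^^ n) z))"
    by (simp add: not_eventually)
  then have "infinite {n. \<not> (\<forall>z\<in>K. B < norm ((f ^^ n) z))}"
    unfolding cofinite_eq_sequentially[symmetric] frequently_cofinite by simp
  from infinite_enumerate[OF this]
  obtain k :: "nat \<Rightarrow> nat" where k: "strict_mono k"
    and bad: "\<And>n. \<not> (\<forall>z\<in>K. B < norm ((f ^^ k n) z))" by auto
  \<comment> \<open>The shift by one keeps the indices positive, as the family excludes the identity.\<close>
  define s where "s = (\<lambda>n. f ^^ k (Suc n))"
  have "k (Suc n) \<ge> 1" for n using seq_suble[OF k, of "Suc n"] by simp
  then have "range s \<subseteq> {f ^^ n | n. n \<ge> 1}" unfolding s_def by auto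
  then obtain r where r: "strict_mono r" and
      lim: "(\<exists>g. \<forall>K. compact K \<and> K \<subseteq> U \<longrightarrow>
             uniform_limit K (\<lambda>n. s (r n)) g sequentially) \<or>
          (\<forall>K. compact K \<and> K \<subseteq> U \<longrightarrow>
             (\<forall>B. \<forall>\<^sub>F n in sequentially. \<forall>z\<in>K. B < norm (s (r n) z)))"
    using normal unfolding normal_family_on_def by blast
  from lim show False
  proof
    assume "\<exists>g. \<forall>K. compact K \<and> K \<subseteq> U \<longrightarrow> uniform_limit K (\<lambda>n. s (r n)) g sequentially"
    then obtain g where "uniform_limit {w} (\<lambda>n. s (r n)) g sequentially"
      using w(1) by (meson compact_sing empty_subsetI insert_subset)
    then have fin: "(\<lambda>n. s (r n) w) \<longlonglongrightarrow> g w"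
      by (rule tendsto_uniform_limitI) simp
    have sub: "strict_mono (\<lambda>n. k (Suc (r n)))"
      using k r by (simp add: strict_mono_def)
    have "filterlim (\<lambda>n. (f ^^ (k (Suc (r n)))) w) at_infinity sequentially"
      by (rule filterlim_compose[OF w(2) filterlim_subseq[OF sub]])
    then show False
      using not_tendsto_and_filterlim_at_infinity[OF _ fin] by (simp add: s_def)
  next
    assume "\<forall>K. compact K \<and> K \<subseteq> U \<longrightarrow>
             (\<forall>B. \<forall>\<^sub>F n in sequentially. \<forall>z\<in>K. B < norm (s (r n) z))"
    then have "\<forall>\<^sub>F n in sequentially. \<forall>z\<in>K. B < norm (s (r n) z)" using K by blast
    then obtain n where "\<forall>z\<in>K. B < norm (s (r n) z)"
      unfolding eventually_sequentially by blast
    then show False using bad[of "Suc (r n)"] unfolding s_def by blast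
  qed
qed

text \<open>
  By the local statement, a neighbourhood on which the iterates are normal consists either of
  escaping points only or of non-escaping points only. The escaping points are thus open and closed
  in the connected set \<open>V\<close>, and compactness makes the escape uniform.
\<close>
lemma fatou_escape_uniform:
  assumes V: "open V" "connected V" "V \<subseteq> fatou_set f"
    and p: "p \<in> V" "filterlim (\<lambda>n. (f ^^ n) p) at_infinity sequentially"
    and K: "compact K" "K \<subseteq> V"
  shows "\<forall>\<^sub>F n in sequentially. \<forall>z\<in>K. B < norm ((f ^^ n) z)"
proof -
  define E where "E = {z. filterlim (\<lambda>n. (f ^^ n) z) at_infinity sequentially}"
  have unif_imp: "U \<subseteq> E" if "\<And>K B. compact K \<Longrightarrow> K \<subseteq> U \<Longrightarrow>
     \<forall>\<^sub>F n in sequentially. \<forall>z\<in>K. B < norm ((f ^^ n) z)" for U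
  proof
    fix z assume "z \<in> U"
    then have "\<forall>\<^sub>F n in sequentially. B < norm ((f ^^ n) z)" for B
      using that[of "{z}" B] by auto
    then show "z \<in> E"
      unfolding E_def by (simp add: filterlim_at_infinity_conv_norm_at_top filterlim_at_top_dense)
  qed
  have nbhd: "\<exists>U. open U \<and> z \<in> U \<and> (U \<inter> E = {} \<or> (\<forall>K B. compact K \<longrightarrow> K \<subseteq> U \<longrightarrow>
     (\<forall>\<^sub>F n in sequentially. \<forall>z\<in>K. B < norm ((f ^^ n) z))))" if "z \<in> V" for z
  proof -
    have "z \<in> fatou_set f" using V(3) that by blast
    then obtain U where U: "open U" "z \<in> U" "normal_family_on U {f ^^ n | n. n \<ge> 1}"
      unfolding fatou_set_def by blast
    have "\<forall>K B. compact K \<longrightarrow> K \<subseteq> U \<longrightarrow>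
        (\<forall>\<^sub>F n in sequentially. \<forall>z\<in>K. B < norm ((f ^^ n) z))" if "U \<inter> E \<noteq> {}"
    proof (intro allI impI)
      fix K B assume K: "compact K" "K \<subseteq> U"
      from that obtain w where "w \<in> U" "filterlim (\<lambda>n. (f ^^ n) w) at_infinity sequentially"
        unfolding E_def by auto
      from normal_escape_uniform[OF U(3) this K]
      show "\<forall>\<^sub>F n in sequentially. \<forall>z\<in>K. B < norm ((f ^^ n) z)" .
    qed
    then show ?thesis using U(1,2) by (intro exI[of _ U]) auto
  qed
  have nbhd': "\<exists>U. open U \<and> z \<in> U \<and> (U \<inter> E = {} \<or> U \<subseteq> E)" if zV: "z \<in> V" for z
  proof -
    obtain U where "open U" "z \<in> U" "U \<inter> E = {} \<or> (\<forall>K B. compact K \<longrightarrow> K \<subseteq> U \<longrightarrow>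
     (\<forall>\<^sub>F n in sequentially. \<forall>z\<in>K. B < norm ((f ^^ n) z)))"
      using nbhd[OF zV] by blast
    then show ?thesis using unif_imp[of U] by blast
  qed
  have "V \<subseteq> E"
  proof -
    define V1 where "V1 = \<Union>{U. open U \<and> U \<subseteq> E}"
    define V2 where "V2 = \<Union>{U. open U \<and> U \<inter> E = {}}"
    have opn: "open V1" "open V2" unfolding V1_def V2_def by auto
    have V12: "V1 \<subseteq> E" "V2 \<inter> E = {}" unfolding V1_def V2_def by auto
    have sub: "V \<subseteq> V1 \<union> V2"
    proof
      fix z assume "z \<in> V"
      from nbhd'[OF this] obtain U where "open U" "z \<in> U" "U \<inter> E = {} \<or> U \<subseteq> E" by blast
      then show "z \<in> V1 \<union> V2" unfolding V1_def V2_def by auto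
    qed
    have "p \<in> E" using p unfolding E_def by simp
    then have "p \<in> V1" using sub p(1) V12 by blast
    then have "V2 \<inter> V = {}"
      using connectedD[OF V(2) opn _ sub] V12 p(1) by blast
    then show ?thesis using sub V12 by blast
  qed
  have "\<exists>e>0. (\<forall>\<^sub>F n in sequentially. \<forall>y\<in>cball z e. B < norm ((f ^^ n) y))" if "z \<in> K" for z
  proof -
    have "z \<in> V" "z \<in> E" using that K(2) \<open>V \<subseteq> E\<close> by auto
    then obtain U where U: "open U" "z \<in> U" "\<forall>K B. compact K \<longrightarrow> K \<subseteq> U \<longrightarrow>
       (\<forall>\<^sub>F n in sequentially. \<forall>z\<in>K. B < norm ((f ^^ n) z))"
      using nbhd[of z] by blast
    then obtain e where "e > 0" "cball z e \<subseteq> U" using open_contains_cball by blast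
    then show ?thesis using U(3) compact_cball by blast
  qed
  then have "\<exists>e. \<forall>z\<in>K. e z > 0 \<and> (\<forall>\<^sub>F n in sequentially. \<forall>y\<in>cball z (e z). B < norm ((f ^^ n) y))"
    by (intro bchoice ballI)
  then obtain e where e: "\<And>z. z \<in> K \<Longrightarrow> e z > 0"
    "\<And>z. z \<in> K \<Longrightarrow> \<forall>\<^sub>F n in sequentially. \<forall>y\<in>cball z (e z). B < norm ((f ^^ n) y)"
    by blast
  obtain T where T: "T \<subseteq> K" "finite T" "K \<subseteq> (\<Union>c\<in>T. ball c (e c))"
  proof (rule compactE_image[OF K(1), of K "\<lambda>z. ball z (e z)"])
    show "K \<subseteq> (\<Union>c\<in>K. ball c (e c))"
    proof
      fix z assume "z \<in> K"
      then show "z \<in> (\<Union>c\<in>K. ball c (e c))" using e(1)[of z] by (intro UN_I[of z]) simp_all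
    qed
  qed simp
  have "\<forall>\<^sub>F n in sequentially. \<forall>c\<in>T. \<forall>y\<in>cball c (e c). B < norm ((f ^^ n) y)"
    using T(1,2) e(2) by (intro eventually_ball_finite) auto
  then show ?thesis
  proof eventually_elim
    case (elim n)
    show ?case
    proof
      fix z assume "z \<in> K"
      then obtain c where "c \<in> T" "z \<in> ball c (e c)" using T(3) by blast
      then show "B < norm ((f ^^ n) z)" using elim by (auto simp: less_imp_le)
    qed
  qed
qed

section \<open>Harnack's inequality\<close>

text \<open>
  Harnack's inequality for the positive harmonic function \<open>ln (norm h)\<close>, whose constant at half
  the radius is \<open>(1 + 1/2) / (1 - 1/2) = 3\<close>. Writing \<open>h = exp g\<close> with \<open>Re g > 0\<close>, the Cayley
  transform that sends the right half-plane to the disc and \<open>g a\<close> to \<open>0\<close> reduces it to the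
  Schwarz lemma.
\<close>
lemma harnack_norm_le_cube:
  assumes hol: "h holomorphic_on ball a r" and "r > 0"
    and big: "\<And>z. z \<in> ball a r \<Longrightarrow> 1 < norm (h z)"
    and z: "norm (z - a) \<le> r / 2"
  shows "norm (h z) \<le> norm (h a) ^ 3"
proof -
  have nz: "h x \<noteq> 0" if "x \<in> ball a r" for x using big[OF that] by auto
  obtain g where holg: "g holomorphic_on ball a r" and g: "\<And>x. x \<in> ball a r \<Longrightarrow> exp (g x) = h x"
    using holomorphic_logarithm_exists[of "ball a r" h a] hol nz \<open>r > 0\<close> by auto
  have norm_h: "norm (h x) = exp (Re (g x))" if "x \<in> ball a r" for x
    using g[OF that] by (metis norm_exp_eq_Re)
  have pos: "Re (g x) > 0" if "x \<in> ball a r" for x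
    using big[OF that] norm_h[OF that] by simp
  have a: "a \<in> ball a r" using \<open>r > 0\<close> by simp
  define c where "c = Re (g a)"
  have c: "c > 0" using pos[OF a] by (simp add: c_def)
  \<comment> \<open>The Cayley transform of \<open>g\<close>, on the unit disc.\<close>
  define \<phi> where "\<phi> = (\<lambda>\<zeta>::complex. (g (a + r * \<zeta>) - g a) / (g (a + r * \<zeta>) + cnj (g a)))"
  have inb: "a + r * \<zeta> \<in> ball a r" if "\<zeta> \<in> ball 0 1" for \<zeta> :: complex
    using that \<open>r > 0\<close> by (simp add: dist_norm norm_mult)
  have den: "g (a + r * \<zeta>) + cnj (g a) \<noteq> 0" if "\<zeta> \<in> ball 0 1" for \<zeta> :: complex
    using pos[OF inb[OF that]] pos[OF a] by (auto simp: complex_eq_iff)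
  have holc: "(\<lambda>\<zeta>. g (a + r * \<zeta>)) holomorphic_on ball 0 1"
  proof -
    have "g \<circ> (\<lambda>\<zeta>. a + r * \<zeta>) holomorphic_on ball 0 1"
      by (rule holomorphic_on_compose_gen[OF _ holg]) (use inb in \<open>auto intro!: holomorphic_intros\<close>)
    then show ?thesis by (simp add: o_def)
  qed
  have hol\<phi>: "\<phi> holomorphic_on ball 0 1"
    unfolding \<phi>_def using den holc by (intro holomorphic_intros) auto
  have less: "norm (\<phi> \<zeta>) < 1" if "norm \<zeta> < 1" for \<zeta> :: complex
  proof -
    have \<zeta>: "\<zeta> \<in> ball 0 1" using that by simp
    define w where "w = g (a + r * \<zeta>)"
    have w: "Re w > 0" using pos[OF inb[OF \<zeta>]] by (simp add: w_def)
    have "norm (w + cnj (g a)) ^ 2 - norm (w - g a) ^ 2 = 4 * Re w * c"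
      unfolding cmod_power2 by (simp add: c_def power2_eq_square algebra_simps)
    then have "norm (w - g a) ^ 2 < norm (w + cnj (g a)) ^ 2" using mult_pos_pos[OF w c] by linarith
    then have "norm (w - g a) < norm (w + cnj (g a))" by (rule power_less_imp_less_base) simp
    moreover from this have "norm (w + cnj (g a)) > 0" using norm_ge_zero less_le_trans le_less_trans by blast
    ultimately show ?thesis
      unfolding \<phi>_def w_def[symmetric] by (simp only: norm_divide divide_less_eq_1_pos)
  qed
  define \<zeta> where "\<zeta> = (z - a) / r"
  have \<zeta>: "norm \<zeta> \<le> 1/2" using z \<open>r > 0\<close> by (simp add: \<zeta>_def norm_divide field_simps)
  have z_eq: "a + r * \<zeta> = z" using \<open>r > 0\<close> by (simp add: \<zeta>_def)
  have zb: "z \<in> ball a r" using z \<open>r > 0\<close> by (simp add: dist_norm norm_minus_commute)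
  have "norm (\<phi> \<zeta>) \<le> norm \<zeta>"
    using Schwarz_Lemma(1)[OF hol\<phi> _ less, of \<zeta>] \<zeta> by (simp add: \<phi>_def)
  then have half: "norm (\<phi> \<zeta>) \<le> 1/2" using \<zeta> by simp
  define w where "w = g z"
  have w: "Re w > 0" using pos[OF zb] by (simp add: w_def)
  have ne: "w + cnj (g a) \<noteq> 0" using w c by (auto simp: complex_eq_iff c_def)
  have "norm (w - g a) / norm (w + cnj (g a)) \<le> 1/2"
    using half unfolding \<phi>_def z_eq w_def norm_divide .
  then have "norm (w - g a) \<le> 1/2 * norm (w + cnj (g a))"
    using ne by (simp add: divide_le_eq)
  then have "norm (w - g a) ^ 2 \<le> (1/2 * norm (w + cnj (g a))) ^ 2"
    by (intro power_mono) auto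
  then have sq: "(Re w - c)\<^sup>2 + (Im w - Im (g a))\<^sup>2 \<le> 1/4 * ((Re w + c)\<^sup>2 + (Im w - Im (g a))\<^sup>2)"
    unfolding power_mult_distrib cmod_power2 by (simp add: c_def power2_eq_square)
  have "(Re w - c)\<^sup>2 \<le> 1/4 * (Re w + c)\<^sup>2"
    using sq zero_le_power2[of "Im w - Im (g a)"] by argo
  \<comment> \<open>The Apollonius disc of ratio \<open>1/2\<close> meets the real axis at \<open>c / 3\<close> and \<open>3 * c\<close>.\<close>
  then have "3 * Re w * Re w + 3 * c * c \<le> 10 * Re w * c"
    by (simp add: power2_eq_square algebra_simps)
  then have "(3 * Re w - c) * (Re w - 3 * c) \<le> 0" by (simp add: algebra_simps)
  then have "Re w \<le> 3 * c" using c w by (smt (verit) mult_pos_pos)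
  then have "exp (Re w) \<le> exp c ^ 3" by (simp flip: exp_of_nat_mult)
  then show ?thesis using norm_h[OF zb] norm_h[OF a] by (simp add: w_def c_def)
qed

section \<open>The entire map\<close>

definition expm_quot :: "complex \<Rightarrow> complex" where
  "expm_quot z = (if z = 0 then 1 else (1 - exp (- z)) / z)"

definition cubic :: "complex \<Rightarrow> complex" where
  "cubic z = z * (z\<^sup>2 + 4 * (of_real pi)\<^sup>2)"

text \<open>
  The map \<open>z - (1 - exp (- z)) / cubic z\<close>, with the quotient expanded into partial fractions.
  Each summand is a translate of an entire function, so the removable singularities
  at \<open>0\<close> and \<open>\<plusminus> 2 \<pi> \<i>\<close> need no separate values.
\<close>
definition drift_map :: "complex \<Rightarrow> complex" where
  "drift_map z = z - (expm_quot z / 4 - expm_quot (z - 2 * of_real pi * \<i>) / 8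
      - expm_quot (z + 2 * of_real pi * \<i>) / 8) / (of_real pi)\<^sup>2"

lemma expm_quot_holomorphic: "expm_quot holomorphic_on UNIV"
proof (rule no_isolated_singularity'[of "{0}"])
  fix z :: complex assume "z \<in> {0}"
  have "((\<lambda>z::complex. 1 - exp (- z)) has_field_derivative 1) (at 0)"
    by (auto intro!: derivative_eq_intros)
  then have "((\<lambda>z::complex. (1 - exp (- z)) / z) \<longlongrightarrow> 1) (at 0)"
    by (simp add: has_field_derivative_iff)
  then have "(expm_quot \<longlongrightarrow> 1) (at 0)"
    by (rule Lim_transform_eventually) (auto simp: expm_quot_def eventually_at_filter)
  with \<open>z \<in> {0}\<close> show "(expm_quot \<longlongrightarrow> expm_quot z) (at z within UNIV)"
    by (simp add: expm_quot_def)
next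
  have "(\<lambda>z. (1 - exp (- z)) / z) holomorphic_on (UNIV - {0})"
    by (intro holomorphic_intros) auto
  then show "expm_quot holomorphic_on (UNIV - {0})"
    by (rule holomorphic_transform) (auto simp: expm_quot_def)
qed auto

lemma drift_map_holomorphic: "drift_map holomorphic_on UNIV"
proof -
  have shift: "(\<lambda>z. expm_quot (z + c)) holomorphic_on UNIV" for c
    using holomorphic_on_compose_gen[OF _ expm_quot_holomorphic, of "\<lambda>z. z + c" UNIV]
    by (simp add: o_def holomorphic_intros)
  have eq: "drift_map = (\<lambda>z. z - (expm_quot z / 4 - expm_quot (z + - (2 * of_real pi * \<i>)) / 8
      - expm_quot (z + 2 * of_real pi * \<i>) / 8) / (of_real pi)\<^sup>2)"
    by (simp add: drift_map_def fun_eq_iff)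
  show ?thesis
    unfolding eq by (intro holomorphic_intros shift expm_quot_holomorphic) auto
qed

text \<open>
  The factors \<open>z \<mp> 2 \<pi> \<i>\<close> of \<open>cubic z\<close> are periods of \<open>exp\<close>, so all three summands of
  \<open>drift_map\<close> have the same numerator \<open>1 - exp (- z)\<close> and the claim is the partial fraction
  decomposition of \<open>1 / cubic z\<close>.
\<close>
lemma drift_map_eq:
  assumes "z \<notin> {0, 2 * of_real pi * \<i>, - (2 * of_real pi * \<i>)}"
  shows "drift_map z = z - (1 - exp (- z)) / cubic z"
proof -
  define p where "p = complex_of_real pi"
  define c where "c = 2 * p * \<i>"
  have p: "p \<noteq> 0" by (simp add: p_def)
  have cc: "c * c = - (4 * p\<^sup>2)" by (simp add: c_def power2_eq_square algebra_simps)
  have z: "z \<noteq> 0" "z - c \<noteq> 0" "z + c \<noteq> 0"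
    using assms by (auto simp: c_def p_def eq_neg_iff_add_eq_0)
  have fac: "z\<^sup>2 + 4 * p\<^sup>2 = (z - c) * (z + c)"
    using cc by (simp add: algebra_simps power2_eq_square)
  have e1: "exp (- (z - c)) = exp (- z)" and e2: "exp (- (z + c)) = exp (- z)"
    by (simp_all add: c_def p_def exp_diff exp_minus exp_add mult.commute mult.left_commute inverse_eq_divide)
  have "1 / z / 4 - 1 / (z - c) / 8 - 1 / (z + c) / 8 = 1 / 4 * (1 / z - z / ((z - c) * (z + c)))"
  proof -
    have "1 / (z - c) + 1 / (z + c) = 2 * z / ((z - c) * (z + c))"
      using add_frac_eq[OF z(2,3), of 1 1] by simp
    moreover have "a / 4 - b / 8 - d / 8 = 1 / 4 * (a - e)" if "b + d = 2 * e" for a b d e :: complex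
    proof -
      have "d = 2 * e - b" using that by (simp add: eq_diff_eq add.commute)
      then show ?thesis by (simp only:) (simp add: diff_divide_distrib algebra_simps)
    qed
    ultimately show ?thesis by (metis times_divide_eq_right)
  qed
  also have "1 / z - z / ((z - c) * (z + c)) = - (c * c) / (z * ((z - c) * (z + c)))"
    using z by (simp add: divide_simps) (simp add: algebra_simps)
  also have "1 / 4 * \<dots> = p\<^sup>2 / (z * ((z - c) * (z + c)))" by (simp add: cc)
  finally have pf: "1 / z / 4 - 1 / (z - c) / 8 - 1 / (z + c) / 8 = p\<^sup>2 / cubic z"
    by (simp add: cubic_def fac flip: p_def)
  have "expm_quot z / 4 - expm_quot (z - c) / 8 - expm_quot (z + c) / 8 =
      (1 - exp (- z)) * (1 / z / 4 - 1 / (z - c) / 8 - 1 / (z + c) / 8)"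
    unfolding expm_quot_def e1 e2 using z by (simp add: algebra_simps)
  also have "\<dots> / p\<^sup>2 = (1 - exp (- z)) / cubic z"
    unfolding pf using p by simp
  finally show ?thesis by (simp add: drift_map_def c_def p_def)
qed

lemma cubic_norm_bounds:
  assumes "norm z \<ge> 10"
  shows "norm z ^ 3 / 4 \<le> norm (cubic z)" "norm (cubic z) \<le> 2 * norm z ^ 3"
proof -
  have p: "norm (4 * (complex_of_real pi)\<^sup>2) \<le> 64"
  proof -
    have "pi * pi \<le> 4 * 4" using pi_less_4 by (intro mult_mono) auto
    then show ?thesis by (simp add: norm_mult norm_power power2_eq_square)
  qed
  have zz: "norm z ^ 2 \<ge> 100" using power_mono[OF assms, of 2] by simp
  have "norm (z\<^sup>2) - norm (4 * (complex_of_real pi)\<^sup>2) \<le> norm (z\<^sup>2 + 4 * (of_real pi)\<^sup>2)"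
    by (rule norm_diff_ineq)
  then have "norm z ^ 2 / 4 \<le> norm (z\<^sup>2 + 4 * (of_real pi)\<^sup>2)"
    using p zz unfolding norm_power by linarith
  then have "norm z * (norm z ^ 2 / 4) \<le> norm z * norm (z\<^sup>2 + 4 * (of_real pi)\<^sup>2)"
    by (intro mult_left_mono) auto
  then show "norm z ^ 3 / 4 \<le> norm (cubic z)"
    unfolding cubic_def norm_mult by (simp add: power3_eq_cube power2_eq_square)
  have "norm (z\<^sup>2 + 4 * (of_real pi)\<^sup>2) \<le> norm (z\<^sup>2) + norm (4 * (complex_of_real pi)\<^sup>2)"
    by (rule norm_triangle_ineq)
  then have "norm (z\<^sup>2 + 4 * (of_real pi)\<^sup>2) \<le> 2 * norm z ^ 2"
    using p zz unfolding norm_power by linarith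
  then have "norm z * norm (z\<^sup>2 + 4 * (of_real pi)\<^sup>2) \<le> norm z * (2 * norm z ^ 2)"
    by (intro mult_left_mono) auto
  then show "norm (cubic z) \<le> 2 * norm z ^ 3"
    unfolding cubic_def norm_mult by (simp add: power3_eq_cube power2_eq_square)
qed

lemma drift_map_eq_large:
  assumes "norm z \<ge> 10"
  shows "drift_map z = z - (1 - exp (- z)) / cubic z"
  using assms pi_less_4 by (intro drift_map_eq) (auto simp: norm_mult)

lemma drift_map_norm_le:
  assumes "norm z \<ge> 10"
  shows "norm (drift_map z) \<le> exp (2 * norm z)"
proof -
  have "norm z ^ 3 \<ge> 10 ^ 3" using assms by (intro power_mono) auto
  then have c: "norm (cubic z) \<ge> 1" using cubic_norm_bounds(1)[OF assms] by simp
  have "norm ((1 - exp (- z)) / cubic z) \<le> norm (1 - exp (- z)) / 1"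
    unfolding norm_divide using c by (intro divide_left_mono) auto
  also have "\<dots> \<le> 1 + exp (norm z)"
    using norm_triangle_ineq4[of 1 "exp (- z)"] norm_exp[of "- z"] unfolding norm_minus_cancel norm_one by linarith
  finally have "norm (drift_map z) \<le> norm z + (1 + exp (norm z))"
    unfolding drift_map_eq_large[OF assms]
    using norm_triangle_ineq4[of z "(1 - exp (- z)) / cubic z"] by linarith
  also have "\<dots> \<le> 2 * exp (norm z)" using exp_ge_add_one_self[of "norm z"] by linarith
  also have "\<dots> \<le> exp (norm z) * exp (norm z)"
    using exp_ge_add_one_self[of "norm z"] assms by (intro mult_right_mono; linarith)
  finally show ?thesis by (simp flip: exp_add)
qed

section \<open>Order of growth\<close>

lemma pole_count_entire:
  assumes "f holomorphic_on UNIV"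
  shows "pole_count r f = 0"
  using not_is_pole_holomorphic[OF open_UNIV UNIV_I assms] by (simp add: pole_count_def)

text \<open>
  For an entire function only the proximity term remains. Nonnegativity matters because the real
  logarithm is extended to negative arguments by \<open>ln (- x) = ln x\<close>.
\<close>
lemma nevanlinna_char_entire_bounds:
  assumes "f holomorphic_on UNIV" and "B \<ge> 0"
    and "\<And>z. norm z = r \<Longrightarrow> norm (f z) \<le> exp B" and "r \<ge> 0"
  shows "0 \<le> nevanlinna_char r f" "nevanlinna_char r f \<le> B"
proof -
  define L where "L = (\<lambda>t. log_plus (norm (f (of_real r * cis t))))"
  have "counting_fun r f = 0"
    by (simp add: counting_fun_def pole_count_entire[OF assms(1)])
  moreover have "L t \<le> B" for t
  proof (cases "f (of_real r * cis t) = 0")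
    case False
    have "norm (f (of_real r * cis t)) \<le> exp B"
      by (rule assms(3)) (use assms(4) in \<open>simp add: norm_mult\<close>)
    then have "ln (norm (f (of_real r * cis t))) \<le> B" using False
      by (metis ln_exp ln_le_cancel_iff exp_gt_zero zero_less_norm_iff)
    then show ?thesis using assms(2) by (simp add: L_def log_plus_def)
  qed (use assms(2) in \<open>simp add: L_def log_plus_def\<close>)
  then have "integral {0..2*pi} L \<le> 2 * pi * B"
  proof (cases "L integrable_on {0..2*pi}")
    case True
    then have "integral {0..2*pi} L \<le> integral {0..2*pi} (\<lambda>_. B)"
      by (rule integral_le) (use \<open>\<And>t. L t \<le> B\<close> in auto)
    then show ?thesis by simp
  qed (use assms(2) in \<open>simp add: not_integrable_integral\<close>)
  moreover have "0 \<le> integral {0..2*pi} L"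
  proof (cases "L integrable_on {0..2*pi}")
    case True
    then show ?thesis
      by (rule Henstock_Kurzweil_Integration.integral_nonneg) (simp add: L_def log_plus_def)
  qed (simp add: not_integrable_integral)
  ultimately show "0 \<le> nevanlinna_char r f" "nevanlinna_char r f \<le> B"
    unfolding nevanlinna_char_def proximity_fun_def L_def[symmetric] by (simp_all add: field_simps)
qed

lemma drift_map_finite_order: "growth_order drift_map < \<infinity>"
proof -
  have "growth_order drift_map \<le> 2"
    unfolding growth_order_def
  proof (rule Limsup_bounded, rule eventually_mono[OF eventually_ge_at_top[of 10]])
    fix r :: real assume r: "10 \<le> r"
    have le: "norm (drift_map z) \<le> exp (2 * r)" if "norm z = r" for z
      using drift_map_norm_le[of z] that r by simp
    note bounds = nevanlinna_char_entire_bounds[OF drift_map_holomorphic _ le]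
    have "nevanlinna_char r drift_map \<le> 2 * r" using r by (intro bounds) auto
    also have "2 * r \<le> r * r" using r by (intro mult_right_mono) auto
    finally have T: "nevanlinna_char r drift_map \<le> r * r" .
    have T0: "nevanlinna_char r drift_map \<ge> 0" using r by (intro bounds) auto
    have "ln (nevanlinna_char r drift_map) \<le> 2 * ln r"
    proof (cases "nevanlinna_char r drift_map = 0")
      case False
      then have "ln (nevanlinna_char r drift_map) \<le> ln (r * r)" using T T0 by simp
      then show ?thesis using r by (simp add: ln_mult)
    qed (use r in simp)
    then have "log_plus (nevanlinna_char r drift_map) \<le> 2 * ln r"
      using r by (simp add: log_plus_def)
    moreover have "ln r > 0" using r by simp
    ultimately have "log_plus (nevanlinna_char r drift_map) / ln r \<le> 2"
      by (simp add: divide_le_eq)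
    then show "ereal (log_plus (nevanlinna_char r drift_map) / ln r) \<le> 2" by simp
  qed
  also have "2 < (\<infinity> :: ereal)" by simp
  finally show ?thesis .
qed

section \<open>Repelling fixed points on the imaginary axis\<close>

lemma exp_minus_two_pi_i_int: "exp (- (2 * of_real pi * \<i> * of_int k)) = (1::complex)"
  unfolding exp_eq_1 by (auto intro!: exI[of _ "- k"])

lemma fixed_point_regular:
  fixes k :: int
  assumes "\<bar>k\<bar> \<ge> 2"
  shows "2 * of_real pi * \<i> * of_int k \<notin> {0, 2 * of_real pi * \<i>, - (2 * of_real pi * \<i>)}"
proof -
  have "2 * of_real pi * \<i> * of_int k = 2 * of_real pi * \<i> * (of_int m :: complex) \<longleftrightarrow> k = m" for m
    by simp
  from this[of 0] this[of 1] this[of "-1"] show ?thesis using assms by auto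
qed

lemma drift_map_fixed_point:
  fixes k :: int
  assumes "\<bar>k\<bar> \<ge> 2"
  shows "drift_map (2 * of_real pi * \<i> * of_int k) = 2 * of_real pi * \<i> * of_int k"
  using drift_map_eq[OF fixed_point_regular[OF assms]] by (simp only: exp_minus_two_pi_i_int) simp

text \<open>
  A polynomial \<open>p\<close> with the infinitely many fixed points \<open>2 \<pi> \<i> k\<close> is the identity, which
  would force \<open>exp (- z) = 1\<close> throughout.
\<close>
lemma drift_map_transcendental: "transcendental_entire drift_map"
  unfolding transcendental_entire_def
proof (intro conjI drift_map_holomorphic notI)
  assume "\<exists>p. \<forall>z. drift_map z = poly p z"
  then obtain p where p: "\<And>z. drift_map z = poly p z" by blast
  define g where "g = (\<lambda>k::int. 2 * of_real pi * \<i> * of_int k :: complex)"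
  have "inj g" by (auto simp: g_def inj_def)
  then have "infinite (g ` {2..})" using infinite_Ici[of "2::int"]
    by (simp add: finite_image_iff inj_on_subset)
  moreover have "g ` {2..} \<subseteq> {z. poly (p - [:0, 1:]) z = 0}"
    using drift_map_fixed_point by (auto simp: g_def simp flip: p)
  ultimately have "p - [:0, 1:] = 0"
    using poly_roots_finite finite_subset by blast
  then have id: "drift_map z = z" for z by (simp add: p)
  have "drift_map 10 = 10 - (1 - exp (- 10)) / cubic 10"
    by (rule drift_map_eq_large) simp
  moreover have "cubic 10 \<noteq> 0" using cubic_norm_bounds(1)[of 10] by auto
  ultimately have "exp (- 10 :: complex) = 1" using id[of 10] by simp
  then have "norm (exp (- 10 :: complex)) = 1" by simp
  then show False by (simp add: norm_exp_eq_Re)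
qed

text \<open>
  The multiplier at the fixed point \<open>w\<close> is \<open>1 - 1 / cubic w\<close>. Since \<open>cubic\<close> maps the imaginary
  axis to itself, this is \<open>1\<close> plus a nonzero imaginary number and has modulus greater than \<open>1\<close>.
\<close>
lemma fixed_point_in_julia:
  fixes k :: int
  assumes k: "\<bar>k\<bar> \<ge> 2"
  shows "2 * of_real pi * \<i> * of_int k \<in> julia_set drift_map"
proof (rule repelling_fixed_point_in_julia[OF drift_map_holomorphic drift_map_fixed_point[OF k]])
  define w :: complex where "w = 2 * of_real pi * \<i> * of_int k"
  define S :: "complex set" where "S = - {0, 2 * of_real pi * \<i>, - (2 * of_real pi * \<i>)}"
  have S: "open S" "w \<in> S"
    using fixed_point_regular[OF k] by (auto simp: S_def w_def intro!: finite_imp_closed)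
  have ew: "exp (- w) = 1" unfolding w_def by (rule exp_minus_two_pi_i_int)
  define y where "y = 8 * pi ^ 3 * of_int k * (1 - (of_int k)\<^sup>2)"
  have cw: "cubic w = \<i> * of_real y"
    by (simp add: cubic_def w_def y_def power2_eq_square power3_eq_cube algebra_simps)
  have "k * k \<ge> 2 * 2" using mult_mono[OF k k] by simp
  then have "real_of_int (k * k) \<ge> 4" by linarith
  then have "(of_int k :: real)\<^sup>2 \<noteq> 1" by (simp add: power2_eq_square)
  then have y: "y \<noteq> 0" using k by (auto simp: y_def)
  have c0: "cubic w \<noteq> 0" using cw y by simp
  have "cubic holomorphic_on UNIV" unfolding cubic_def by (intro holomorphic_intros)
  then have c': "(cubic has_field_derivative deriv cubic w) (at w)"
    by (rule holomorphic_derivI) auto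
  have "((\<lambda>z. z - (1 - exp (- z)) / cubic z) has_field_derivative 1 - 1 / cubic w) (at w)"
    by (rule derivative_eq_intros c' refl c0 | simp add: ew c0)+
  then have "(drift_map has_field_derivative 1 - 1 / cubic w) (at w)"
    by (rule has_field_derivative_transform_within_open[OF _ S])
       (auto simp: S_def drift_map_eq)
  then have "deriv drift_map w = 1 - 1 / cubic w" by (rule DERIV_imp_deriv)
  also have "\<dots> = Complex 1 (1 / y)" using y by (simp add: cw complex_eq_iff Re_divide Im_divide power2_eq_square)
  finally have "norm (deriv drift_map w) = sqrt (1 + (1 / y)\<^sup>2)" by (simp add: complex_norm)
  moreover have "sqrt 1 < sqrt (1 + (1 / y)\<^sup>2)" using y by (intro real_sqrt_less_mono) simp
  ultimately show "1 < norm (deriv drift_map (2 * of_real pi * \<i> * of_int k))"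
    by (simp add: w_def)
qed

section \<open>The petals\<close>

text \<open>
  Near the imaginary axis \<open>z ^ 4\<close> is close to the positive real axis, so the hypothesis keeps
  \<open>z\<close> away from it. Only in such a cone is \<open>exp (- z)\<close> negligible for large \<open>z\<close>.
\<close>
lemma cone_of_quartic_region:
  assumes "K > 0" "Re z > 0" and neg: "Re (z ^ 4) - K * \<bar>Im (z ^ 4)\<bar> < 0"
  shows "norm z / (8 * (K + 1)) \<le> Re z"
proof (rule ccontr)
  assume outside: "\<not> ?thesis"
  define x y r where "x = Re z" and "y = Im z" and "r = norm z"
  have x: "x > 0" and z: "z = Complex x y" using assms by (simp_all add: x_def y_def)
  have xr: "8 * (K + 1) * x < r"
    using outside assms(1) by (simp add: x_def r_def not_le divide_simps mult_ac)
  have r2: "r\<^sup>2 = x\<^sup>2 + y\<^sup>2" by (simp add: r_def x_def y_def cmod_power2)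
  have r: "r > 0" using xr x assms(1) by (smt (verit) mult_pos_pos)
  have yr: "\<bar>y\<bar> \<le> r" by (simp add: y_def r_def abs_Im_le_cmod)
  have z4: "z ^ 4 = Complex (x^4 - 6 * x\<^sup>2 * y\<^sup>2 + y^4) (4 * x * y * (x\<^sup>2 - y\<^sup>2))"
    by (simp add: z complex_eq_iff power4_eq_xxxx power2_eq_square algebra_simps)
  have re4: "Re (z ^ 4) = x^4 - 6 * x\<^sup>2 * y\<^sup>2 + y^4" and im4: "Im (z ^ 4) = 4 * x * y * (x\<^sup>2 - y\<^sup>2)"
    by (simp_all add: z4)
  have re: "Re (z ^ 4) = r ^ 4 - 8 * x\<^sup>2 * y\<^sup>2"
  proof -
    have "r ^ 4 = (x\<^sup>2 + y\<^sup>2)\<^sup>2" by (simp flip: r2)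
    then show ?thesis unfolding re4 by (simp add: power2_eq_square power4_eq_xxxx algebra_simps)
  qed
  have "\<bar>Im (z ^ 4)\<bar> = 4 * x * (\<bar>y\<bar> * \<bar>x\<^sup>2 - y\<^sup>2\<bar>)"
    using x by (simp add: im4 abs_mult)
  also have "\<bar>x\<^sup>2 - y\<^sup>2\<bar> \<le> r\<^sup>2" by (simp add: r2 abs_le_iff)
  then have "4 * x * (\<bar>y\<bar> * \<bar>x\<^sup>2 - y\<^sup>2\<bar>) \<le> 4 * x * (r * r\<^sup>2)"
    using x yr r by (intro mult_left_mono mult_mono) auto
  finally have "K * \<bar>Im (z ^ 4)\<bar> \<le> K * (4 * x * (r * r\<^sup>2))" using assms(1) by simp
  also have "\<dots> \<le> 4 * (K + 1) * x * r ^ 3"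
    using x r assms(1) by (simp add: power3_eq_cube power2_eq_square algebra_simps)
  also have "4 * (K + 1) * x * r ^ 3 < (r / 2) * r ^ 3"
  proof (rule mult_strict_right_mono)
    show "4 * (K + 1) * x < r / 2" using xr by (simp add: algebra_simps)
  qed (use r in simp)
  finally have im: "K * \<bar>Im (z ^ 4)\<bar> < r ^ 4 / 2" by (simp add: eval_nat_numeral)
  have "8 * x < 8 * (K + 1) * x" using x assms(1) by simp
  then have "8 * x \<le> r" using xr by linarith
  then have "(8 * x) * \<bar>y\<bar> \<le> r * r" using yr x r by (intro mult_mono) auto
  then have "((8 * x) * \<bar>y\<bar>)\<^sup>2 \<le> (r * r)\<^sup>2" using x by (intro power_mono) auto
  then have "64 * (x\<^sup>2 * y\<^sup>2) \<le> r ^ 4" by (simp add: power_mult_distrib power2_eq_square eval_nat_numeral mult_ac)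
  then have "8 * x\<^sup>2 * y\<^sup>2 \<le> r ^ 4 / 8" by simp
  then have "Re (z ^ 4) - K * \<bar>Im (z ^ 4)\<bar> > 0" using im re zero_less_power[OF r, of 4] by linarith
  then show False using neg by simp
qed

text \<open>
  In the cone \<open>exp (- z)\<close> tends to \<open>0\<close>, hence \<open>drift_map z = z - (1 + o(1)) / z ^ 3\<close>. In the
  coordinate \<open>z ^ 4\<close> the map is therefore the translation by \<open>-4\<close> up to an error \<open>o(1)\<close>: infinity
  behaves like a parabolic fixed point.
\<close>
lemma drift_map_asymptotics_in_cone:
  assumes c: "c > 0" and \<epsilon>: "\<epsilon> > 0"
  obtains R where "R > 0"
    "\<And>z. norm z \<ge> R \<Longrightarrow> c * norm z \<le> Re z \<Longrightarrow> norm (drift_map z - z) \<le> \<epsilon>"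
    "\<And>z. norm z \<ge> R \<Longrightarrow> c * norm z \<le> Re z \<Longrightarrow> norm (drift_map z ^ 4 - z ^ 4 + 4) \<le> \<epsilon>"
proof -
  define F where "F = inf at_infinity (principal {z. c * norm z \<le> Re z})"
  \<comment> \<open>\<open>drift_map z - z = v z / z ^ 3\<close>, and \<open>v\<close> tends to \<open>-1\<close> in the cone.\<close>
  define v where "v = (\<lambda>z::complex. - ((1 - exp (- z)) / (1 + 4 * (of_real pi)\<^sup>2 * (inverse z)\<^sup>2)))"
  have inv: "(inverse \<longlongrightarrow> 0) F"
    unfolding F_def by (rule tendsto_mono[OF inf_le1 tendsto_inverse_0])
  have nrm: "filterlim norm at_top F"
    unfolding F_def by (rule filterlim_mono[OF filterlim_norm_at_top order_refl inf_le1])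
  have cone: "\<forall>\<^sub>F z in F. c * norm z \<le> Re z"
    unfolding F_def eventually_inf_principal by simp
  have "filterlim (\<lambda>z. c * norm z) at_top F"
    by (rule filterlim_tendsto_pos_mult_at_top[OF tendsto_const c nrm])
  then have "((\<lambda>z. exp (- (c * norm z))) \<longlongrightarrow> 0) F"
    by (intro filterlim_compose[OF exp_at_bot] filterlim_compose[OF filterlim_uminus_at_bot_at_top])
  then have ex: "((\<lambda>z. exp (- z)) \<longlongrightarrow> 0) F"
    by (rule Lim_null_comparison[rotated]) (use cone in eventually_elim, simp add: norm_exp_eq_Re)
  have "(v \<longlongrightarrow> - ((1 - 0) / (1 + 4 * (of_real pi)\<^sup>2 * 0\<^sup>2))) F"
    unfolding v_def by (intro tendsto_intros ex inv) simp
  then have v: "(v \<longlongrightarrow> -1) F" by simp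
  have big: "\<forall>\<^sub>F z in F. norm z \<ge> 10"
    using nrm unfolding filterlim_at_top by blast
  have step: "\<forall>\<^sub>F z in F. drift_map z = z + v z * inverse z ^ 3"
    using big
  proof eventually_elim
    case (elim z)
    have z: "z \<noteq> 0" using elim by auto
    have "cubic z = z ^ 3 * (1 + 4 * (of_real pi)\<^sup>2 * (inverse z)\<^sup>2)"
      using z by (simp add: cubic_def field_simps power2_eq_square power3_eq_cube)
    then show ?case using drift_map_eq_large[OF elim] by (simp add: v_def field_simps)
  qed
  have "((\<lambda>z. v z * inverse z ^ 3) \<longlongrightarrow> -1 * 0 ^ 3) F"
    by (intro tendsto_intros v inv)
  then have "((\<lambda>z. v z * inverse z ^ 3) \<longlongrightarrow> 0) F" by simp
  then have "\<forall>\<^sub>F z in F. norm (v z * inverse z ^ 3) < \<epsilon>"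
    using \<epsilon> unfolding tendsto_iff by (simp add: dist_norm)
  with step have A: "\<forall>\<^sub>F z in F. norm (drift_map z - z) \<le> \<epsilon>"
    by eventually_elim simp
  have "((\<lambda>z. 4 * v z + 6 * (v z)\<^sup>2 * inverse z ^ 4 + 4 * v z ^ 3 * inverse z ^ 8 + v z ^ 4 * inverse z ^ 12 + 4)
      \<longlongrightarrow> 4 * (-1) + 6 * (-1)\<^sup>2 * 0 ^ 4 + 4 * (-1) ^ 3 * 0 ^ 8 + (-1) ^ 4 * 0 ^ 12 + 4) F"
    by (intro tendsto_intros v inv)
  then have "((\<lambda>z. 4 * v z + 6 * (v z)\<^sup>2 * inverse z ^ 4 + 4 * v z ^ 3 * inverse z ^ 8 + v z ^ 4 * inverse z ^ 12 + 4)
      \<longlongrightarrow> 0) F" by simp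
  then have "\<forall>\<^sub>F z in F. norm (4 * v z + 6 * (v z)\<^sup>2 * inverse z ^ 4 + 4 * v z ^ 3 * inverse z ^ 8 + v z ^ 4 * inverse z ^ 12 + 4) < \<epsilon>"
    using \<epsilon> unfolding tendsto_iff by (simp add: dist_norm)
  with step big have B: "\<forall>\<^sub>F z in F. norm (drift_map z ^ 4 - z ^ 4 + 4) \<le> \<epsilon>"
  proof eventually_elim
    case (elim z)
    define i where "i = inverse z"
    have "z \<noteq> 0" using elim(2) by auto
    then have "z * i = 1" by (simp add: i_def)
    then have "(z + v z * i ^ 3) ^ 4 - z ^ 4 + 4 =
        4 * v z + 6 * (v z)\<^sup>2 * i ^ 4 + 4 * v z ^ 3 * i ^ 8 + v z ^ 4 * i ^ 12 + 4"
      by algebra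
    then show ?case using elim by (simp add: i_def)
  qed
  from A B have "\<forall>\<^sub>F z in F. norm (drift_map z - z) \<le> \<epsilon> \<and> norm (drift_map z ^ 4 - z ^ 4 + 4) \<le> \<epsilon>"
    by (rule eventually_conj)
  then obtain b where b: "\<And>z. b \<le> norm z \<Longrightarrow> c * norm z \<le> Re z \<Longrightarrow>
      norm (drift_map z - z) \<le> \<epsilon> \<and> norm (drift_map z ^ 4 - z ^ 4 + 4) \<le> \<epsilon>"
    unfolding F_def eventually_inf_principal eventually_at_infinity by auto
  show thesis by (rule that[of "max b 1"]) (use b in auto)
qed

text \<open>
  The region is a sector with vertex \<open>-M\<close> in the coordinate \<open>z ^ 4\<close>, opening to the left; as \<open>K\<close>
  grows it covers all directions except the positive real one. The near-translation by \<open>-4\<close> maps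
  it into itself and lowers \<open>Re (z ^ 4) - K * \<bar>Im (z ^ 4)\<bar>\<close> by at least \<open>3\<close> in each step, which
  forces uniform escape. The last conclusion says that the escape is slow, with steps of
  length at most \<open>1\<close>; it is contrasted below with the fast escape on the real axis.
\<close>
lemma petal_subset_fatou:
  assumes K: "K > 0"
  obtains M where
    "\<And>z. Re z > 0 \<Longrightarrow> Re (z ^ 4) - K * \<bar>Im (z ^ 4)\<bar> < - M \<Longrightarrow>
       z \<in> fatou_set drift_map \<and>
       filterlim (\<lambda>n. (drift_map ^^ n) z) at_infinity sequentially \<and>
       (\<forall>n. norm ((drift_map ^^ n) z) \<le> norm z + real n)"
proof -
  define \<Phi> where "\<Phi> = (\<lambda>z::complex. Re (z ^ 4) - K * \<bar>Im (z ^ 4)\<bar>)"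
  define c where "c = 1 / (8 * (K + 1))"
  have c: "c > 0" using K by (simp add: c_def)
  \<comment> \<open>With this error bound \<open>\<Phi>\<close> changes by at most \<open>-4 + (K + 1) * \<epsilon> = -3\<close>.\<close>
  define \<epsilon> where "\<epsilon> = 1 / (K + 1)"
  have \<epsilon>: "\<epsilon> > 0" "(K + 1) * \<epsilon> = 1" "\<epsilon> \<le> 1" using K by (simp_all add: \<epsilon>_def divide_simps)
  obtain R0 where R0: "R0 > 0"
    "\<And>z. norm z \<ge> R0 \<Longrightarrow> c * norm z \<le> Re z \<Longrightarrow> norm (drift_map z - z) \<le> \<epsilon>"
    "\<And>z. norm z \<ge> R0 \<Longrightarrow> c * norm z \<le> Re z \<Longrightarrow> norm (drift_map z ^ 4 - z ^ 4 + 4) \<le> \<epsilon>"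
    using drift_map_asymptotics_in_cone[OF c \<epsilon>(1)] by blast
  \<comment> \<open>The bound \<open>2 / c\<close> gives \<open>Re z \<ge> 2\<close>, so a step of length \<open>1\<close> stays in the right half-plane.\<close>
  define R where "R = max R0 (2 / c)"
  have "c * (2 / c) \<le> c * R" using c by (intro mult_left_mono) (auto simp: R_def)
  then have R: "R \<ge> R0" "c * R \<ge> 2" "R > 0" using c R0(1) by (auto simp: R_def)
  define M where "M = (K + 1) * R ^ 4"
  have M: "M > 0" using K R(3) by (simp add: M_def)
  define U where "U = {z. Re z > 0 \<and> \<Phi> z < - M}"
  have \<Phi>_bound: "- \<Phi> z \<le> (K + 1) * norm z ^ 4" for z
  proof -
    have "\<bar>Re (z ^ 4)\<bar> \<le> norm z ^ 4" "\<bar>Im (z ^ 4)\<bar> \<le> norm z ^ 4"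
      using abs_Re_le_cmod[of "z ^ 4"] abs_Im_le_cmod[of "z ^ 4"] by (simp_all add: norm_power)
    moreover from this have "K * \<bar>Im (z ^ 4)\<bar> \<le> K * norm z ^ 4" using K by simp
    ultimately show ?thesis unfolding \<Phi>_def distrib_right by linarith
  qed
  have large: "norm z \<ge> R" if "z \<in> U" for z
  proof -
    have "(K + 1) * R ^ 4 < (K + 1) * norm z ^ 4"
      using that \<Phi>_bound[of z] by (simp add: U_def M_def)
    then have "R ^ 4 < norm z ^ 4" using K by simp
    then show ?thesis using power_less_imp_less_base[of R 4 "norm z"] by simp
  qed
  have cone: "c * norm z \<le> Re z" if "z \<in> U" for z
    using cone_of_quartic_region[OF K, of z] that M by (simp add: U_def \<Phi>_def c_def)
  have near: "norm (drift_map z - z) \<le> 1" if "z \<in> U" for z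
    using R0(2)[of z] large[OF that] cone[OF that] R(1) \<epsilon>(3) by linarith
  have drop: "\<Phi> (drift_map z) \<le> \<Phi> z - 3" if "z \<in> U" for z
  proof -
    define d where "d = drift_map z ^ 4 - z ^ 4 + 4"
    have d: "norm d \<le> \<epsilon>" using R0(3)[of z] large[OF that] cone[OF that] R(1) by (simp add: d_def)
    have eq: "drift_map z ^ 4 = z ^ 4 - 4 + d" by (simp add: d_def)
    have "\<bar>Re d\<bar> \<le> \<epsilon>" "\<bar>Im d\<bar> \<le> \<epsilon>"
      using abs_Re_le_cmod[of d] abs_Im_le_cmod[of d] d by linarith+
    moreover from this have "\<bar>Im (z ^ 4)\<bar> - \<epsilon> \<le> \<bar>Im (drift_map z ^ 4)\<bar>" by (simp add: eq)
    then have "K * (\<bar>Im (z ^ 4)\<bar> - \<epsilon>) \<le> K * \<bar>Im (drift_map z ^ 4)\<bar>" using K by simp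
    moreover have "Re (drift_map z ^ 4) = Re (z ^ 4) - 4 + Re d" by (simp add: eq)
    ultimately show ?thesis using \<epsilon>(2) unfolding \<Phi>_def by (simp add: algebra_simps)
  qed
  have inv: "drift_map z \<in> U" if "z \<in> U" for z
  proof -
    have "c * R \<le> c * norm z" using large[OF that] c by simp
    then have "Re z \<ge> 2" using cone[OF that] R(2) by linarith
    moreover have "\<bar>Re (drift_map z - z)\<bar> \<le> 1" using abs_Re_le_cmod near[OF that] order_trans by blast
    ultimately have "Re (drift_map z) > 0" by simp
    then show ?thesis using drop[OF that] that by (simp add: U_def)
  qed
  have orbit: "(drift_map ^^ n) z \<in> U \<and> \<Phi> ((drift_map ^^ n) z) \<le> - 3 * real n \<and>
      norm ((drift_map ^^ n) z) \<le> norm z + real n" if "z \<in> U" for z n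
  proof (induction n)
    case 0
    then show ?case using that M by (simp add: U_def)
  next
    case (Suc n)
    let ?w = "(drift_map ^^ n) z"
    have "norm (drift_map ?w) \<le> norm ?w + 1"
      using near[of ?w] Suc norm_triangle_sub[of "drift_map ?w" ?w] by linarith
    then show ?case using Suc inv[of ?w] drop[of ?w] by auto
  qed
  define a where "a = (\<lambda>n::nat. (3 * real n / (K + 1)) powr (1/4))"
  have a_top: "filterlim a at_top sequentially"
    unfolding a_def using K by real_asymp
  have lower: "a n \<le> norm ((drift_map ^^ n) z)" if "z \<in> U" for z n
  proof -
    let ?w = "(drift_map ^^ n) z"
    have "3 * real n \<le> (K + 1) * norm ?w ^ 4"
      using orbit[OF that, of n] \<Phi>_bound[of ?w] by linarith
    then have "3 * real n / (K + 1) \<le> norm ?w ^ 4" using K by (simp add: divide_le_eq mult.commute)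
    then have "a n \<le> (norm ?w ^ 4) powr (1/4)"
      unfolding a_def using K by (intro powr_mono2) auto
    also have "(norm ?w ^ 4) powr (1/4) = norm ?w"
      by (cases "?w = 0") (simp_all add: powr_powr flip: powr_numeral)
    finally show ?thesis .
  qed
  have "open U"
    unfolding U_def \<Phi>_def by (intro open_Collect_conj open_Collect_less continuous_intros)
  then have fatou: "U \<subseteq> fatou_set drift_map"
    using a_top lower by (rule uniformly_escaping_domain_subset_fatou)
  show thesis
  proof (rule that[of M])
    fix z :: complex assume "Re z > 0" "Re (z ^ 4) - K * \<bar>Im (z ^ 4)\<bar> < - M"
    then have z: "z \<in> U" by (simp add: U_def \<Phi>_def)
    have "filterlim (\<lambda>n. norm ((drift_map ^^ n) z)) at_top sequentially"
      by (rule filterlim_at_top_mono[OF a_top]) (use lower[OF z] in simp)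
    then show "z \<in> fatou_set drift_map \<and>
       filterlim (\<lambda>n. (drift_map ^^ n) z) at_infinity sequentially \<and>
       (\<forall>n. norm ((drift_map ^^ n) z) \<le> norm z + real n)"
      using fatou z orbit[OF z] by (auto simp: filterlim_at_infinity_conv_norm_at_top)
  qed
qed

section \<open>Limiting directions\<close>

text \<open>
  Closeness of \<open>z / (\<rho> cis \<theta>)\<close> to \<open>1\<close> controls modulus and argument at the same time and so
  avoids any choice of branch when limiting directions are exhibited.
\<close>
lemma julia_limiting_directionI:
  assumes \<theta>: "\<theta> \<in> {0..<2 * pi}"
    and near: "\<And>\<epsilon> R. \<epsilon> > 0 \<Longrightarrow> \<exists>\<rho>>R. \<exists>z\<in>julia_set f. norm (z / (of_real \<rho> * cis \<theta>) - 1) < \<epsilon>"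
  shows "\<theta> \<in> julia_limiting_directions f"
proof -
  have "\<exists>\<rho> z. \<rho> > real n + 1 \<and> z \<in> julia_set f \<and> norm (z / (of_real \<rho> * cis \<theta>) - 1) < 1 / (real n + 2)" for n
    using near[of "1 / (real n + 2)" "real n + 1"] by auto
  then obtain \<rho> z where \<rho>: "\<And>n. \<rho> n > real n + 1" and z: "\<And>n. z n \<in> julia_set f"
    and close: "\<And>n. norm (z n / (of_real (\<rho> n) * cis \<theta>) - 1) < 1 / (real n + 2)"
    by metis
  define w where "w = (\<lambda>n. z n / (of_real (\<rho> n) * cis \<theta>))"
  have \<rho>0: "\<rho> n > 0" for n using \<rho>[of n] by linarith
  have z_eq: "z n = of_real (\<rho> n) * cis \<theta> * w n" for n
    using \<rho>0[of n] by (simp add: w_def)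
  have half: "1 / (real n + 2) \<le> 1 / 2" for n by (simp add: divide_simps)
  have w_close: "norm (w n - 1) < 1 / (real n + 2)" for n using close by (simp add: w_def)
  have w_half: "norm (w n - 1) < 1 / 2" for n using w_close[of n] half[of n] by linarith
  have w_norm: "norm (w n) \<ge> 1 / 2" for n
    using norm_triangle_ineq2[of 1 "1 - w n"] w_half[of n] by (simp add: norm_minus_commute)
  then have w0: "w n \<noteq> 0" for n by (metis norm_zero not_le zero_less_divide_1_iff zero_less_numeral)
  define \<phi> where "\<phi> = (\<lambda>n. \<theta> + Arg (w n))"
  have arg: "is_Arg (z n) (\<phi> n)" for n
  proof -
    have "w n = of_real (norm (w n)) * exp (\<i> * of_real (Arg (w n)))"
      using is_Arg_Arg[OF w0] unfolding is_Arg_def .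
    moreover have "norm (z n) = \<rho> n * norm (w n)" using \<rho>0[of n] by (simp add: z_eq norm_mult)
    ultimately show ?thesis
      unfolding is_Arg_def z_eq[of n]
      by (simp add: \<phi>_def cis_conv_exp exp_add distrib_left norm_mult mult_ac abs_of_pos[OF \<rho>0])
  qed
  have Arg_le: "norm (Arg (w n)) \<le> 2 * (1 / (real n + 2))" for n
  proof -
    have "\<bar>Arg (w n)\<bar> \<le> norm (Ln (w n))" using abs_Im_le_cmod[of "Ln (w n)"] w0 by (simp add: Arg_def)
    also have "\<dots> \<le> 2 * norm (w n - 1)" using norm_Ln_le[OF w_half, of n] by simp
    finally show ?thesis using w_close[of n] by simp
  qed
  have "(\<lambda>n::nat. 2 * (1 / (real n + 2))) \<longlonglongrightarrow> 0" by real_asymp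
  then have "(\<lambda>n. Arg (w n)) \<longlonglongrightarrow> 0"
    by (rule Lim_null_comparison[OF always_eventually[OF allI[OF Arg_le]]])
  then have "(\<lambda>n. \<theta> + Arg (w n)) \<longlonglongrightarrow> \<theta> + 0" by (intro tendsto_add tendsto_const)
  then have lim: "\<phi> \<longlonglongrightarrow> \<theta>" by (simp add: \<phi>_def)
  have unb: "\<not> bounded (range z)"
  proof
    assume "bounded (range z)"
    then obtain B where B: "\<And>n. norm (z n) \<le> B" unfolding bounded_iff by blast
    obtain n where n: "2 * B < real n" using reals_Archimedean2[of "2 * B"] by blast
    have "real n * (1 / 2) \<le> \<rho> n * norm (w n)"
      using \<rho>[of n] w_norm[of n] by (intro mult_mono) auto
    also have "\<dots> = norm (z n)" using \<rho>0[of n] by (simp add: z_eq norm_mult)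
    finally show False using B[of n] n by simp
  qed
  have "z n \<noteq> 0" for n using w0[of n] \<rho>0[of n] by (simp add: z_eq)
  then have sub: "range z \<subseteq> julia_set f - {0}" using z by auto
  show ?thesis
    unfolding julia_limiting_directions_def mem_Collect_eq
    by (intro CollectI conjI \<theta> exI[of _ z] exI[of _ \<phi>] sub unb allI arg lim)
qed

text \<open>
  The two conditions describe the directions of the open right half-plane other than the
  positive real axis. Then \<open>cis (4 \<theta>) \<noteq> 1\<close>, so a sufficiently large \<open>K\<close> gives a petal that contains
  every large point whose argument is near \<open>\<theta>\<close>.
\<close>
lemma no_limiting_direction_in_right_half_plane:
  assumes \<theta>: "cos \<theta> > 0" "cos (4 * \<theta>) \<noteq> 1"
  shows "\<theta> \<notin> julia_limiting_directions drift_map"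
proof
  assume "\<theta> \<in> julia_limiting_directions drift_map"
  then obtain z \<phi> where z: "range z \<subseteq> julia_set drift_map - {0}" "\<not> bounded (range z)"
    and \<phi>: "\<And>n. is_Arg (z n) (\<phi> n)" "\<phi> \<longlonglongrightarrow> \<theta>"
    unfolding julia_limiting_directions_def by blast
  \<comment> \<open>If \<open>sin (4 * \<theta>) = 0\<close>, then \<open>z ^ 4\<close> points to the negative axis and any \<open>K\<close> will do.\<close>
  obtain K where K: "K > 0" "cos (4 * \<theta>) - K * \<bar>sin (4 * \<theta>)\<bar> < 0"
  proof (cases "sin (4 * \<theta>) = 0")
    case True
    then have "cos (4 * \<theta>) = -1"
      using \<theta>(2) sin_zero_abs_cos_one[of "4 * \<theta>"] by (auto simp: abs_if split: if_splits)
    then show ?thesis using that[of 1] True by simp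
  next
    case False
    then show ?thesis
      using that[of "2 / \<bar>sin (4 * \<theta>)\<bar>"] cos_le_one[of "4 * \<theta>"] by auto
  qed
  define m where "m = (cos (4 * \<theta>) - K * \<bar>sin (4 * \<theta>)\<bar>) / 2"
  have m: "m < 0" "cos (4 * \<theta>) - K * \<bar>sin (4 * \<theta>)\<bar> < m" using K(2) by (simp_all add: m_def)
  obtain M where M: "\<And>z. Re z > 0 \<Longrightarrow> Re (z ^ 4) - K * \<bar>Im (z ^ 4)\<bar> < - M \<Longrightarrow> z \<in> fatou_set drift_map"
    using petal_subset_fatou[OF K(1)] by metis
  have "(\<lambda>n. cos (4 * \<phi> n) - K * \<bar>sin (4 * \<phi> n)\<bar>) \<longlonglongrightarrow> cos (4 * \<theta>) - K * \<bar>sin (4 * \<theta>)\<bar>"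
    by (intro tendsto_intros \<phi>(2))
  then have ev1: "\<forall>\<^sub>F n in sequentially. cos (4 * \<phi> n) - K * \<bar>sin (4 * \<phi> n)\<bar> < m"
    using m(2) by (rule order_tendstoD(2))
  have "(\<lambda>n. cos (\<phi> n)) \<longlonglongrightarrow> cos \<theta>" by (intro tendsto_intros \<phi>(2))
  then have ev2: "\<forall>\<^sub>F n in sequentially. cos (\<phi> n) > 0"
    using \<theta>(1) by (rule order_tendstoD(1))
  have "\<forall>\<^sub>F n in sequentially. norm (z n) \<le> max 1 (M / - m)"
    using ev1 ev2
  proof eventually_elim
    case (elim n)
    define r where "r = norm (z n)"
    have r: "r > 0" using z(1) by (auto simp: r_def)
    have polar: "z n = of_real r * cis (\<phi> n)"
      using \<phi>(1)[of n] by (simp add: is_Arg_def r_def cis_conv_exp)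
    have z4: "z n ^ 4 = of_real (r ^ 4) * cis (4 * \<phi> n)"
      unfolding polar by (simp add: power_mult_distrib Complex.DeMoivre)
    have "Re (z n) > 0" using elim(2) r by (simp add: polar)
    moreover have "z n \<notin> fatou_set drift_map" using z(1) by (auto simp: julia_set_def)
    ultimately have "\<not> Re (z n ^ 4) - K * \<bar>Im (z n ^ 4)\<bar> < - M" using M by blast
    moreover have "Re (z n ^ 4) - K * \<bar>Im (z n ^ 4)\<bar> = r ^ 4 * (cos (4 * \<phi> n) - K * \<bar>sin (4 * \<phi> n)\<bar>)"
      using r by (simp add: z4 abs_mult algebra_simps)
    moreover have "r ^ 4 * (cos (4 * \<phi> n) - K * \<bar>sin (4 * \<phi> n)\<bar>) \<le> r ^ 4 * m"
      using elim(1) r by (intro mult_left_mono) auto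
    ultimately have "- M \<le> r ^ 4 * m" by linarith
    then have "r ^ 4 \<le> M / - m" using m(1) by (simp add: field_simps)
    moreover have "r \<le> r ^ 4" if "r \<ge> 1" using power_increasing[of 1 4 r] that by simp
    ultimately show ?case unfolding r_def[symmetric] by linarith
  qed
  then obtain N where N: "\<And>n. n \<ge> N \<Longrightarrow> norm (z n) \<le> max 1 (M / - m)"
    unfolding eventually_sequentially by blast
  have "range z \<subseteq> z ` {..<N} \<union> cball 0 (max 1 (M / - m))"
  proof
    fix y assume "y \<in> range z"
    then obtain n where "y = z n" by blast
    then show "y \<in> z ` {..<N} \<union> cball 0 (max 1 (M / - m))"
      using N[of n] by (cases "n < N") auto
  qed
  moreover have "bounded (z ` {..<N} \<union> cball 0 (max 1 (M / - m)))"
    by (simp add: finite_imp_bounded)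
  ultimately show False using z(2) bounded_subset by blast
qed

section \<open>The left half-plane\<close>

text \<open>
  The relative change of \<open>cubic\<close> over a bounded distance tends to \<open>0\<close>; this is what lets
  \<open>exp (- z) / cubic z\<close> be treated as an exponential on discs of fixed radius.
\<close>
lemma cubic_near_constant:
  assumes z0: "norm z0 \<ge> 1000" and z: "norm (z - z0) \<le> 6"
  shows "norm (cubic z - cubic z0) \<le> norm (cubic z0) / 8"
proof -
  define r where "r = norm z0"
  have r: "r \<ge> 1000" using z0 by (simp add: r_def)
  have zr: "norm z \<le> 11 / 10 * r" using norm_triangle_sub[of z z0] z r by (simp add: r_def)
  have p: "norm (4 * (complex_of_real pi)\<^sup>2) \<le> r * r"
  proof -
    have "pi * pi \<le> 4 * 4" using pi_less_4 by (intro mult_mono) auto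
    moreover have "1000 * 1000 \<le> r * r" using r by (intro mult_mono) auto
    ultimately show ?thesis by (simp add: norm_mult norm_power power2_eq_square)
  qed
  have "cubic z - cubic z0 = (z - z0) * (z * z + z * z0 + z0 * z0 + 4 * (of_real pi)\<^sup>2)"
    by (simp add: cubic_def power2_eq_square algebra_simps)
  then have eq: "norm (cubic z - cubic z0) = norm (z - z0) * norm (z * z + z * z0 + z0 * z0 + 4 * (of_real pi)\<^sup>2)"
    by (simp add: norm_mult)
  have "norm (z * z + z * z0 + z0 * z0 + 4 * (of_real pi)\<^sup>2) \<le>
      norm (z * z) + norm (z * z0) + norm (z0 * z0) + norm (4 * (complex_of_real pi)\<^sup>2)"
    by (intro norm_triangle_mono norm_triangle_ineq order_refl)
  also have "\<dots> \<le> 11 / 10 * r * (11 / 10 * r) + 11 / 10 * r * r + r * r + r * r"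
    unfolding norm_mult[of z] norm_mult[of z0] r_def[symmetric]
    using zr p r by (intro add_mono mult_mono) auto
  also have "\<dots> \<le> 5 * (r * r)" using r by simp
  finally have "norm (cubic z - cubic z0) \<le> 6 * (5 * (r * r))"
    unfolding eq using z by (intro mult_mono) auto
  also have "\<dots> \<le> r ^ 3 / 4 / 8"
  proof -
    have "960 * (r * r) \<le> r * (r * r)" using r by (intro mult_right_mono) auto
    then show ?thesis using r by (simp add: power3_eq_cube)
  qed
  also have "\<dots> \<le> norm (cubic z0) / 8"
    using cubic_norm_bounds(1)[of z0] z0 by (simp add: r_def)
  finally show ?thesis .
qed

text \<open>
  Near \<open>z0 = \<rho> cis \<theta>\<close> the map is dominated by \<open>exp (- z) / cubic z0\<close>, which is huge and runs
  through a full period on a disc of fixed radius. It therefore attains a value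
  \<open>2 \<pi> \<i> k\<close> of comparable size there. Taking logarithms turns the exact equation into a fixed point
  problem, which Brouwer's theorem solves.
\<close>
lemma preimage_of_fixed_point:
  assumes \<theta>: "cos \<theta> < 0"
  shows "\<forall>\<^sub>F \<rho> in at_top. \<exists>z. \<exists>k::nat. k \<ge> 2 \<and> norm (z - of_real \<rho> * cis \<theta>) \<le> 6 \<and>
           drift_map z = 2 * of_real pi * \<i> * of_nat k"
proof -
  define d where "d = - cos \<theta>"
  have d: "d > 0" using \<theta> by (simp add: d_def)
  \<comment> \<open>The factor \<open>2 * \<rho> ^ 3\<close> bounds \<open>cubic\<close>; the factor \<open>20 * \<rho>\<close> makes \<open>k\<close> large compared with \<open>z\<close>.\<close>
  have "\<forall>\<^sub>F \<rho> in at_top. exp (d * \<rho>) \<ge> 20 * \<rho> * (2 * \<rho> ^ 3)" using d by real_asymp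
  moreover have "\<forall>\<^sub>F \<rho> in at_top. \<rho> \<ge> (1000::real)" by (rule eventually_ge_at_top)
  ultimately show ?thesis
  proof eventually_elim
    case (elim \<rho>)
    define z0 where "z0 = of_real \<rho> * cis \<theta>"
    have n0: "norm z0 = \<rho>" using elim by (simp add: z0_def norm_mult)
    define q0 where "q0 = cubic z0"
    have q0: "\<rho> ^ 3 / 4 \<le> norm q0" "norm q0 \<le> 2 * \<rho> ^ 3"
      using cubic_norm_bounds[of z0] elim(2) by (simp_all add: q0_def n0)
    have r3: "\<rho> ^ 3 \<ge> 1000 ^ 3" using elim(2) by (intro power_mono) auto
    have q0_big: "norm q0 \<ge> 100" using q0(1) r3 by simp
    then have q0_nz: "q0 \<noteq> 0" by auto
    define E where "E = exp (- z0) / q0"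
    have "norm E = exp (d * \<rho>) / norm q0" by (simp add: E_def norm_divide norm_exp_eq_Re z0_def d_def)
    moreover have "20 * \<rho> * norm q0 \<le> exp (d * \<rho>)"
    proof -
      have "20 * \<rho> * norm q0 \<le> 20 * \<rho> * (2 * \<rho> ^ 3)"
        using q0(2) elim(2) by (intro mult_left_mono) auto
      then show ?thesis using elim(1) by linarith
    qed
    ultimately have E: "norm E \<ge> 20 * \<rho>" using q0_nz by (simp add: le_divide_eq)
    \<comment> \<open>The index for which \<open>2 \<pi> k\<close> matches the modulus of the dominant term \<open>E\<close> up to a factor \<open>2\<close>.\<close>
    define k where "k = nat \<lfloor>norm E / (2 * pi)\<rfloor>"
    have k: "real k \<le> norm E / (2 * pi)" "norm E / (2 * pi) - 1 \<le> real k"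
      unfolding k_def by (simp_all add: of_nat_floor)
    have "20 * \<rho> / (2 * 4) \<le> norm E / (2 * pi)"
      using E pi_less_4 elim(2) by (intro frac_le) auto
    then have k2: "2 * \<rho> \<le> real k" using k(2) elim(2) by simp
    define N where "N = 2 * of_real pi * \<i> * complex_of_nat k"
    have nN: "norm N = 2 * pi * real k" by (simp add: N_def norm_mult)
    have "12 * \<rho> \<le> 6 * real k" using k2 by simp
    also have "\<dots> \<le> 2 * pi * real k" using pi_gt3 by (intro mult_right_mono) auto
    finally have N_big: "12 * \<rho> \<le> norm N" by (simp add: nN)
    have N_nz: "N \<noteq> 0" using N_big elim(2) by auto
    have E_nz: "E \<noteq> 0" using E elim(2) by auto
    define b where "b = N / E"
    have b_le: "norm b \<le> 1"
      using k(1) E_nz by (simp add: b_def norm_divide nN field_simps)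
    have "norm E / 2 \<le> norm N"
    proof -
      have "norm E - 2 * pi \<le> norm N" using mult_left_mono[OF k(2), of "2 * pi"] by (simp add: nN algebra_simps)
      then show ?thesis using E elim(2) pi_less_4 by linarith
    qed
    then have b_ge: "norm b \<ge> 1 / 2" using E_nz by (simp add: b_def norm_divide field_simps)
    have b_nz: "b \<noteq> 0" using N_nz E_nz by (simp add: b_def)
    have lnb: "norm (Ln b) \<le> 5"
    proof -
      have "ln (1 / 2) \<le> ln (norm b)" using b_ge by (intro ln_mono) auto
      moreover have "ln (1 / 2 :: real) \<ge> -1" using ln_2_less_1 by (simp add: ln_div)
      moreover have "ln (norm b) \<le> 0" using b_le b_nz by simp
      ultimately have "\<bar>Re (Ln b)\<bar> \<le> 1" unfolding Re_Ln[OF b_nz] by linarith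
      moreover have "\<bar>Im (Ln b)\<bar> \<le> 4"
        using Im_Ln_le_pi[OF b_nz] mpi_less_Im_Ln[OF b_nz] pi_less_4 by linarith
      ultimately show ?thesis using cmod_le[of "Ln b"] by linarith
    qed
    \<comment> \<open>The exact solution of \<open>exp (- z) / q0 = N\<close>, a bounded distance from \<open>z0\<close>.\<close>
    define zs where "zs = z0 - Ln b"
    have zs: "exp (- zs) = N * q0"
      using b_nz E_nz q0_nz by (simp add: zs_def exp_diff exp_minus b_def E_def field_simps)
    \<comment> \<open>The equation \<open>drift_map z = N\<close> reads \<open>exp (- z) = exp (- zs) * A z\<close>, and \<open>A\<close> is close to \<open>1\<close>.\<close>
    define A where "A = (\<lambda>z. (cubic z * (N - z) + 1) / (N * q0))"
    have near: "norm (z - z0) \<le> 6" if "z \<in> cball zs 1" for z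
    proof -
      have "norm (z - zs) \<le> 1" using that by (simp add: dist_norm norm_minus_commute)
      moreover have "z - z0 = (z - zs) - Ln b" by (simp add: zs_def)
      ultimately show ?thesis using lnb norm_triangle_ineq4[of "z - zs" "Ln b"] by (simp only:)
    qed
    have A: "norm (A z - 1) < 1 / 2" if "z \<in> cball zs 1" for z
    proof -
      define s where "s = cubic z / q0"
      have s1: "norm (s - 1) \<le> 1 / 8"
      proof -
        have "s - 1 = (cubic z - cubic z0) / q0" using q0_nz by (simp add: s_def q0_def diff_divide_distrib)
        then show ?thesis
          using cubic_near_constant[OF _ near[OF that]] elim(2) q0_nz n0
          by (simp add: norm_divide q0_def divide_le_eq)
      qed
      then have s2: "norm s \<le> 9 / 8" using norm_triangle_sub[of s 1] by simp
      have "norm z \<le> 2 * \<rho>" using near[OF that] norm_triangle_sub[of z z0] n0 elim(2) by simp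
      then have "norm (z / N) \<le> 2 * \<rho> / (12 * \<rho>)"
        unfolding norm_divide using N_big elim(2) by (intro frac_le) auto
      then have zN: "norm (z / N) \<le> 1 / 6" using elim(2) by simp
      have "norm (N * q0) \<ge> 100 * 1"
        unfolding norm_mult mult.commute[of "norm N"] using q0_big N_big elim(2) by (intro mult_mono) auto
      then have t: "norm (1 / (N * q0)) \<le> 1 / 100"
        unfolding norm_divide by (intro frac_le) auto
      have "A z - 1 = (s - 1) - z / N * s + 1 / (N * q0)"
        using N_nz q0_nz by (simp add: A_def s_def field_simps)
      also have "norm \<dots> \<le> norm (s - 1) + norm (z / N) * norm s + norm (1 / (N * q0))"
        by (intro norm_triangle_mono order_refl) (metis norm_mult norm_triangle_ineq4)
      also have "\<dots> \<le> 1 / 8 + 1 / 6 * (9 / 8) + 1 / 100"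
        using s1 s2 zN t by (intro add_mono mult_mono) auto
      also have "\<dots> < 1 / 2" by simp
      finally show ?thesis .
    qed
    have A_dom: "A z \<notin> \<real>\<^sub>\<le>\<^sub>0" "A z \<noteq> 0" "norm (Ln (A z)) \<le> 1" if "z \<in> cball zs 1" for z
    proof -
      have "\<bar>Re (A z - 1)\<bar> < 1 / 2" using A[OF that] abs_Re_le_cmod le_less_trans by blast
      then have "Re (A z) > 0" unfolding minus_complex.sel one_complex.sel by linarith
      then show "A z \<notin> \<real>\<^sub>\<le>\<^sub>0" "A z \<noteq> 0" by (auto simp: complex_nonpos_Reals_iff)
      show "norm (Ln (A z)) \<le> 1" using norm_Ln_le[OF A[OF that]] A[OF that] by simp
    qed
    have "continuous_on (cball zs 1) (\<lambda>z. zs - Ln (A z))"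
    proof (intro continuous_intros)
      show "continuous_on (cball zs 1) A"
        unfolding A_def cubic_def using N_nz q0_nz by (intro continuous_intros) auto
    qed (use A_dom in auto)
    moreover have "(\<lambda>z. zs - Ln (A z)) \<in> cball zs 1 \<rightarrow> cball zs 1"
      using A_dom by (auto simp: dist_norm)
    ultimately obtain z where z: "z \<in> cball zs 1" "zs - Ln (A z) = z"
      using brouwer_ball[of 1 zs "\<lambda>z. zs - Ln (A z)"] zero_less_one by metis
    have "- z = - zs + Ln (A z)" using z(2) by (simp add: algebra_simps)
    then have "exp (- z) = exp (- zs) * exp (Ln (A z))" by (simp only: exp_add)
    also have "\<dots> = N * q0 * A z" using A_dom(2)[OF z(1)] by (simp add: zs)
    also have "\<dots> = cubic z * (N - z) + 1" using N_nz q0_nz by (simp add: A_def)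
    finally have ez: "exp (- z) = cubic z * (N - z) + 1" .
    have zn: "norm z \<ge> 10" using near[OF z(1)] norm_triangle_sub[of z0 z] n0 elim(2)
      by (simp add: norm_minus_commute)
    then have "norm z ^ 3 \<ge> 10 ^ 3" by (intro power_mono) auto
    then have "cubic z \<noteq> 0" using cubic_norm_bounds(1)[OF zn] by auto
    then have "drift_map z = N" using drift_map_eq_large[OF zn] by (simp add: ez)
    moreover have "k \<ge> 2" using k2 elim(2) by linarith
    ultimately show ?case using near[OF z(1)] by (auto simp: N_def z0_def)
  qed
qed

lemma drift_map_not_constant: "\<not> drift_map constant_on UNIV"
proof
  assume "drift_map constant_on UNIV"
  then have "drift_map (2 * of_real pi * \<i> * of_int 2) = drift_map (2 * of_real pi * \<i> * of_int 3)"
    unfolding constant_on_def by auto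
  then show False by (simp only: drift_map_fixed_point) simp
qed

text \<open>
  The points found near the ray are preimages of repelling fixed points, and the Julia set is
  backward invariant.
\<close>
lemma limiting_direction_left_half_plane:
  assumes "\<theta> \<in> {0..<2 * pi}" and cos: "cos \<theta> < 0"
  shows "\<theta> \<in> julia_limiting_directions drift_map"
proof (rule julia_limiting_directionI[OF assms(1)])
  fix \<epsilon> R :: real assume "\<epsilon> > 0"
  have "\<forall>\<^sub>F \<rho> in at_top. \<rho> > max R (max 1 (6 / \<epsilon>))" by (rule eventually_gt_at_top)
  from eventually_happens[OF eventually_conj[OF this preimage_of_fixed_point[OF cos]]]
  obtain \<rho> z and k :: nat where \<rho>: "\<rho> > max R (max 1 (6 / \<epsilon>))" and "k \<ge> 2"
    and near: "norm (z - of_real \<rho> * cis \<theta>) \<le> 6"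
    and fz: "drift_map z = 2 * of_real pi * \<i> * of_nat k" by auto
  have "drift_map z \<in> julia_set drift_map"
    using fixed_point_in_julia[of "int k"] \<open>k \<ge> 2\<close> by (simp add: fz)
  then have "z \<in> julia_set drift_map"
    using image_fatou_subset_fatou[OF drift_map_holomorphic drift_map_not_constant, of z]
    unfolding julia_set_def by blast
  moreover have "norm (z / (of_real \<rho> * cis \<theta>) - 1) < \<epsilon>"
  proof -
    have "z / (of_real \<rho> * cis \<theta>) - 1 = (z - of_real \<rho> * cis \<theta>) / (of_real \<rho> * cis \<theta>)"
      using \<rho> by (simp add: diff_divide_distrib)
    then have "norm (z / (of_real \<rho> * cis \<theta>) - 1) = norm (z - of_real \<rho> * cis \<theta>) / \<rho>"
      using \<rho> by (simp add: norm_divide norm_mult)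
    also have "\<dots> \<le> 6 / \<rho>" using near \<rho> by (intro divide_right_mono) auto
    also have "\<dots> < \<epsilon>" using \<rho> \<open>\<epsilon> > 0\<close> by (simp add: field_simps)
    finally show ?thesis .
  qed
  moreover have "\<rho> > R" using \<rho> by linarith
  ultimately show "\<exists>\<rho>>R. \<exists>z\<in>julia_set drift_map. norm (z / (of_real \<rho> * cis \<theta>) - 1) < \<epsilon>"
    by blast
qed

lemma limiting_direction_imaginary_axis:
  assumes \<theta>: "\<theta> \<in> {0..<2 * pi}" and s: "\<bar>s\<bar> = 1" and cis: "cis \<theta> = \<i> * of_int s"
  shows "\<theta> \<in> julia_limiting_directions drift_map"
proof (rule julia_limiting_directionI[OF \<theta>])
  fix \<epsilon> R :: real assume "\<epsilon> > 0"
  obtain k :: nat where k: "real k > max 2 R" using reals_Archimedean2 by blast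
  define z where "z = 2 * of_real pi * \<i> * complex_of_int (s * int k)"
  have "z \<in> julia_set drift_map"
    unfolding z_def by (rule fixed_point_in_julia) (use k s in \<open>simp add: abs_mult\<close>)
  moreover have "z = of_real (2 * pi * k) * cis \<theta>" by (simp add: z_def cis)
  then have "norm (z / (of_real (2 * pi * k) * cis \<theta>) - 1) < \<epsilon>" using k \<open>\<epsilon> > 0\<close> by simp
  moreover have "2 * pi * k > R"
  proof -
    have "1 * real k \<le> 2 * pi * real k" using pi_gt3 by (intro mult_right_mono) auto
    then show ?thesis using k by linarith
  qed
  ultimately show "\<exists>\<rho>>R. \<exists>z\<in>julia_set drift_map. norm (z / (of_real \<rho> * cis \<theta>) - 1) < \<epsilon>"
    by (intro exI[of _ "2 * pi * k"] conjI bexI[of _ z])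
qed

section \<open>The positive real axis\<close>

lemma expm_quot_two_pi_i: "expm_quot (2 * of_real pi * \<i>) = 0" "expm_quot (- (2 * of_real pi * \<i>)) = 0"
  by (simp_all add: expm_quot_def exp_minus)

text \<open>
  On the real axis orbits decrease, since \<open>1 - exp (- x)\<close> has the sign of \<open>x\<close>, and far to the
  left the exponential makes them at least double in every step.
\<close>
lemma drift_map_real:
  obtains g where "\<And>x. drift_map (of_real x) = of_real (g x)" "\<And>x. g x \<le> x"
    "\<forall>\<^sub>F x in at_bot. g x \<le> 2 * x"
proof
  define c where "c = (\<lambda>x::real. x\<^sup>2 + 4 * pi\<^sup>2)"
  have c: "c x > 0" for x unfolding c_def by (intro add_nonneg_pos) auto
  define g where "g = (\<lambda>x. if x = 0 then - (1 / (4 * pi\<^sup>2)) else x - (1 - exp (- x)) / (x * c x))"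
  show "drift_map (of_real x) = of_real (g x)" for x
  proof (cases "x = 0")
    case True
    then show ?thesis
      by (simp add: g_def drift_map_def expm_quot_two_pi_i) (simp add: expm_quot_def)
  next
    case False
    then have "complex_of_real x \<notin> {0, 2 * of_real pi * \<i>, - (2 * of_real pi * \<i>)}"
      by (auto simp: complex_eq_iff)
    from drift_map_eq[OF this] show ?thesis
      using False by (simp add: g_def c_def cubic_def exp_of_real flip: of_real_minus)
  qed
  show "g x \<le> x" for x
  proof (cases "x = 0")
    case False
    have "(1 - exp (- x)) / x \<ge> 0" using False by (cases "x > 0") (auto simp: divide_nonpos_neg)
    then have "(1 - exp (- x)) / x / c x \<ge> 0" using c[of x] by (rule divide_nonneg_pos)
    then have "(1 - exp (- x)) / (x * c x) \<ge> 0" by (simp only: divide_divide_eq_left)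
    then show ?thesis using False by (simp only: g_def if_False)
  qed (simp add: g_def)
  have "\<forall>\<^sub>F t::real in at_top. exp t - 1 \<ge> t\<^sup>2 * (t\<^sup>2 + 4 * pi\<^sup>2) \<and> t > 0"
  proof (rule eventually_conj)
    show "\<forall>\<^sub>F t::real in at_top. exp t - 1 \<ge> t\<^sup>2 * (t\<^sup>2 + 4 * pi\<^sup>2)" by real_asymp
  qed (rule eventually_gt_at_top)
  then have "\<forall>\<^sub>F t::real in at_top. g (- t) \<le> 2 * (- t)"
  proof eventually_elim
    case (elim t)
    have "t * (t * c t) \<le> exp t - 1" using elim by (simp add: c_def power2_eq_square)
    then have "t \<le> (exp t - 1) / (t * c t)" using elim c[of t] by (simp add: le_divide_eq)
    moreover have "g (- t) = - t - (exp t - 1) / (t * c t)"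
      using elim by (simp add: g_def c_def divide_simps)
    ultimately show ?case by simp
  qed
  then show "\<forall>\<^sub>F x in at_bot. g x \<le> 2 * x"
    unfolding at_bot_mirror eventually_filtermap .
qed

text \<open>
  Otherwise a disc about a large \<open>x > 0\<close>, with radius proportional to \<open>x\<close>, lies in the Fatou
  set and reaches a point \<open>p\<close> of a petal. All orbits of the disc then escape uniformly, and Harnack's
  inequality bounds the orbit of \<open>x\<close> by the cube of the orbit of \<open>p\<close>. The former grows
  at least exponentially, the latter at most linearly.
\<close>
lemma zero_limiting_direction: "0 \<in> julia_limiting_directions drift_map"
proof (rule julia_limiting_directionI)
  fix \<epsilon> R :: real assume \<epsilon>: "\<epsilon> > 0"
  show "\<exists>\<rho>>R. \<exists>z\<in>julia_set drift_map. norm (z / (of_real \<rho> * cis 0) - 1) < \<epsilon>"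
  proof (rule ccontr)
    assume "\<not> ?thesis"
    then have far: "norm (z / of_real \<rho> - 1) \<ge> \<epsilon>" if "\<rho> > R" "z \<in> julia_set drift_map" for \<rho> z
      using that by (force simp: not_less)
    define e where "e = min \<epsilon> 1"
    have e: "e > 0" "e \<le> \<epsilon>" "e \<le> 1" using \<epsilon> by (simp_all add: e_def)
    \<comment> \<open>The slope of the petal point \<open>p\<close>, small enough that \<open>x\<close> is at half the radius of a disc about \<open>p\<close>.\<close>
    define t where "t = e / 4"
    have t: "t > 0" "t \<le> 1 / 4" using e by (simp_all add: t_def)
    have tt: "t * t \<le> 1 / 4 * (1 / 4)" using t by (intro mult_mono) auto
    define I where "I = 4 * t * (1 - t * t)"
    have I: "I > 0" using t(1) tt unfolding I_def by (intro mult_pos_pos) auto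
    \<comment> \<open>Chosen so that \<open>K * Im ((1 + \<i> * t) ^ 4)\<close> exceeds the real part by at least \<open>1\<close>.\<close>
    define K where "K = 3 / I"
    have K: "K > 0" using I by (simp add: K_def)
    obtain M where M: "\<And>z. Re z > 0 \<Longrightarrow> Re (z ^ 4) - K * \<bar>Im (z ^ 4)\<bar> < - M \<Longrightarrow>
       z \<in> fatou_set drift_map \<and>
       filterlim (\<lambda>n. (drift_map ^^ n) z) at_infinity sequentially \<and>
       (\<forall>n. norm ((drift_map ^^ n) z) \<le> norm z + real n)"
      using petal_subset_fatou[OF K] by metis
    define x where "x = max 1 (max (R + 1) (M + 1))"
    have x: "x \<ge> 1" "x > R" "x > M" by (auto simp: x_def)
    define p where "p = of_real x * Complex 1 t"
    have "Complex 1 t ^ 4 = Complex (1 - 6 * (t * t) + (t * t) * (t * t)) I"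
      by (simp add: complex_eq_iff power4_eq_xxxx I_def algebra_simps)
    then have p4: "p ^ 4 = of_real (x ^ 4) * Complex (1 - 6 * (t * t) + (t * t) * (t * t)) I"
      by (simp add: p_def power_mult_distrib)
    have "Re (p ^ 4) - K * \<bar>Im (p ^ 4)\<bar> = x ^ 4 * (1 - 6 * (t * t) + (t * t) * (t * t) - K * I)"
      using I by (simp add: p4 abs_mult algebra_simps)
    also have "K * I = 3" using I by (simp add: K_def)
    also have "x ^ 4 * (1 - 6 * (t * t) + (t * t) * (t * t) - 3) \<le> x ^ 4 * (-1)"
    proof (rule mult_left_mono)
      have "(t * t) * (t * t) \<le> 1 * 1" using tt by (intro mult_mono) auto
      moreover have "t * t \<ge> 0" by simp
      ultimately show "1 - 6 * (t * t) + (t * t) * (t * t) - 3 \<le> -1" by linarith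
    qed simp
    also have "x ^ 4 * (-1) < - M" using power_increasing[of 1 4 x] x by simp
    finally have petal: "Re (p ^ 4) - K * \<bar>Im (p ^ 4)\<bar> < - M" .
    have "Re p > 0" using x by (simp add: p_def)
    note p_props = M[OF this petal]
    have ball: "ball (of_real x) (e * x) \<subseteq> fatou_set drift_map"
    proof
      fix z assume "z \<in> ball (complex_of_real x) (e * x)"
      then have "norm (z - of_real x) < e * x" by (simp add: dist_norm norm_minus_commute)
      moreover have "z / of_real x - 1 = (z - of_real x) / of_real x" using x by (simp add: diff_divide_distrib)
      ultimately have "norm (z / of_real x - 1) < e" using x by (simp add: norm_divide divide_less_eq)
      then show "z \<in> fatou_set drift_map"
        using far[OF x(2), of z] e(2) by (force simp: julia_set_def)
    qed
    have "p - of_real x = of_real x * (\<i> * of_real t)" by (simp add: p_def complex_eq_iff)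
    then have "norm (p - of_real x) = x * t" using x t(1) by (simp only: norm_mult) simp
    then have px: "norm (p - of_real x) = e * x / 4" by (simp add: t_def)
    have ex: "e * x > 0" using e x by simp
    have p_in: "p \<in> ball (of_real x) (e * x)" using px ex by (simp add: dist_norm norm_minus_commute)
    have sub: "cball p (e * x / 2) \<subseteq> ball (of_real x) (e * x)"
    proof
      fix z assume "z \<in> cball p (e * x / 2)"
      then have "norm (z - p) \<le> e * x / 2" by (simp add: dist_norm norm_minus_commute)
      moreover have "norm (z - of_real x) \<le> norm (z - p) + norm (p - of_real x)"
        using norm_triangle_ineq[of "z - p" "p - of_real x"] by simp
      ultimately have "norm (z - of_real x) < e * x" using px ex by linarith
      then show "z \<in> ball (of_real x) (e * x)" by (simp add: dist_norm norm_minus_commute)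
    qed
    note escape = fatou_escape_uniform[OF open_ball connected_ball ball p_in]
    obtain g where g: "\<And>x. drift_map (of_real x) = of_real (g x)" "\<And>x. g x \<le> x"
      "\<forall>\<^sub>F x in at_bot. g x \<le> 2 * x"
      using drift_map_real by blast
    obtain b where b: "\<And>x. x \<le> b \<Longrightarrow> g x \<le> 2 * x"
      using g(3) unfolding eventually_at_bot_linorder by blast
    have iter: "(drift_map ^^ n) (of_real x) = of_real ((g ^^ n) x)" for n
      by (induction n) (simp_all add: g(1))
    have iter_le: "(g ^^ n) x \<le> x" for n
      by (induction n) (use g(2) order_trans in auto)
    have "\<forall>\<^sub>F n in sequentially. \<forall>z\<in>cball p (e * x / 2). 1 < norm ((drift_map ^^ n) z)"
      using escape[OF _ compact_cball sub] p_props by blast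
    moreover have "\<forall>\<^sub>F n in sequentially. \<forall>z\<in>{of_real x}. max x (max 1 (- b)) < norm ((drift_map ^^ n) z)"
      using p_props ex by (intro escape) auto
    ultimately have "\<forall>\<^sub>F n in sequentially. (\<forall>z\<in>cball p (e * x / 2). 1 < norm ((drift_map ^^ n) z))
        \<and> max x (max 1 (- b)) < \<bar>(g ^^ n) x\<bar>"
      by eventually_elim (simp add: iter)
    then obtain N where N: "\<And>n. n \<ge> N \<Longrightarrow> \<forall>z\<in>cball p (e * x / 2). 1 < norm ((drift_map ^^ n) z)"
      "\<And>n. n \<ge> N \<Longrightarrow> max x (max 1 (- b)) < \<bar>(g ^^ n) x\<bar>"
      unfolding eventually_sequentially by blast
    \<comment> \<open>Real orbits do not increase, so a real orbit that is large in modulus is far to the left.\<close>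
    have neg: "(g ^^ n) x \<le> -1" "(g ^^ n) x \<le> b" if "n \<ge> N" for n
      using N(2)[OF that] iter_le[of n] by linarith+
    have grow: "(g ^^ (N + m)) x \<le> - (2 ^ m)" for m
    proof (induction m)
      case (Suc m)
      have "(g ^^ (N + Suc m)) x \<le> 2 * (g ^^ (N + m)) x" using b[OF neg(2)[of "N + m"]] by simp
      then show ?case using Suc by simp
    qed (use neg(1)[of N] in simp)
    have "2 ^ m \<le> (norm p + real (N + m)) ^ 3" for m
    proof -
      have "norm ((drift_map ^^ (N + m)) (of_real x)) \<le> norm ((drift_map ^^ (N + m)) p) ^ 3"
      proof (rule harnack_norm_le_cube[of _ p "e * x / 2"])
        show "(drift_map ^^ (N + m)) holomorphic_on ball p (e * x / 2)"
          by (rule holomorphic_on_funpow[OF drift_map_holomorphic])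
        show "1 < norm ((drift_map ^^ (N + m)) z)" if "z \<in> ball p (e * x / 2)" for z
          using N(1)[of "N + m"] that ball_subset_cball by (metis le_add1 subsetD)
      qed (use ex px in \<open>auto simp: norm_minus_commute\<close>)
      also have "\<dots> \<le> (norm p + real (N + m)) ^ 3"
      proof (rule power_mono)
        show "norm ((drift_map ^^ (N + m)) p) \<le> norm p + real (N + m)" using p_props by blast
      qed simp
      finally have "\<bar>(g ^^ (N + m)) x\<bar> \<le> (norm p + real (N + m)) ^ 3" by (simp only: iter norm_of_real)
      then show ?thesis using grow[of m] by linarith
    qed
    then have le: "2 ^ m \<le> ((norm p + real N) + real m) ^ 3" for m by (simp add: add.assoc)
    have "\<forall>\<^sub>F m::nat in sequentially. (2::real) ^ m > ((norm p + real N) + real m) ^ 3"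
      by real_asymp
    then obtain m where "(2::real) ^ m > ((norm p + real N) + real m) ^ 3"
      unfolding eventually_sequentially by blast
    then show False using le[of m] by linarith
  qed
qed auto

section \<open>The set of limiting directions\<close>

lemma cos_neg_between:
  assumes "pi / 2 < \<theta>" "\<theta> < 3 * pi / 2"
  shows "cos \<theta> < 0"
  using cos_gt_zero_pi[of "\<theta> - pi"] assms by (simp add: cos_diff)

lemma cos_quadruple_eq_1_imp:
  assumes "cos (4 * \<theta>) = 1"
  obtains n :: int where "\<theta> = of_int n * (pi / 2)"
proof -
  obtain n :: int where "4 * \<theta> = of_int n * 2 * pi"
    using assms unfolding cos_one_2pi_int by blast
  then have "\<theta> = of_int n * (pi / 2)" by linarith
  then show ?thesis by (rule that)
qed

lemma drift_map_limiting_directions: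
  "julia_limiting_directions drift_map = {pi / 2..3 * pi / 2} \<union> {0}"
proof (intro equalityI subsetI)
  fix \<theta> assume L: "\<theta> \<in> julia_limiting_directions drift_map"
  then have range: "0 \<le> \<theta>" "\<theta> < 2 * pi" by (auto simp: julia_limiting_directions_def)
  show "\<theta> \<in> {pi / 2..3 * pi / 2} \<union> {0}"
  proof (rule ccontr)
    assume "\<theta> \<notin> {pi / 2..3 * pi / 2} \<union> {0}"
    then have cases: "0 < \<theta> \<and> \<theta> < pi / 2 \<or> 3 * pi / 2 < \<theta> \<and> \<theta> < 2 * pi"
      using range by auto
    have "cos \<theta> > 0"
      using cases cos_gt_zero_pi[of \<theta>] cos_gt_zero_pi[of "\<theta> - 2 * pi"] by (auto simp: cos_diff)
    moreover have "cos (4 * \<theta>) \<noteq> 1"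
    proof
      assume "cos (4 * \<theta>) = 1"
      then obtain n :: int where n: "\<theta> = of_int n * (pi / 2)" by (rule cos_quadruple_eq_1_imp)
      from cases show False
      proof
        assume "0 < \<theta> \<and> \<theta> < pi / 2"
        then have "0 * (pi / 2) < of_int n * (pi / 2)" "of_int n * (pi / 2) < 1 * (pi / 2)" by (simp_all add: n)
        then have "0 < real_of_int n" "real_of_int n < 1"
          by (simp_all only: mult_less_cancel_right_pos[OF pi_half_gt_zero])
        then have "0 < n" "n < 1" by simp_all
        then show False by linarith
      next
        assume "3 * pi / 2 < \<theta> \<and> \<theta> < 2 * pi"
        then have "3 * (pi / 2) < of_int n * (pi / 2)" "of_int n * (pi / 2) < 4 * (pi / 2)" by (simp_all add: n)
        then have "3 < real_of_int n" "real_of_int n < 4"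
          by (simp_all only: mult_less_cancel_right_pos[OF pi_half_gt_zero])
        then have "3 < n" "n < 4" by simp_all
        then show False by linarith
      qed
    qed
    ultimately show False using no_limiting_direction_in_right_half_plane L by blast
  qed
next
  fix \<theta> assume "\<theta> \<in> {pi / 2..3 * pi / 2} \<union> {0}"
  then consider "\<theta> = 0" | "\<theta> = pi / 2" | "\<theta> = 3 * pi / 2" | "pi / 2 < \<theta>" "\<theta> < 3 * pi / 2"
    by force
  then show "\<theta> \<in> julia_limiting_directions drift_map"
  proof cases
    case 1
    then show ?thesis using zero_limiting_direction by simp
  next
    case 2
    show ?thesis unfolding 2 by (rule limiting_direction_imaginary_axis[of _ 1]) (auto simp: cis_pi_half)
  next
    case 3
    have "cis (3 * pi / 2) = cis pi * cis (pi / 2)" unfolding cis_mult by simp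
    then show ?thesis unfolding 3
      by (intro limiting_direction_imaginary_axis[of _ "-1"]) (auto simp: cis_pi_half)
  next
    case 4
    then show ?thesis
      using pi_gt_zero by (intro limiting_direction_left_half_plane cos_neg_between) auto
  qed
qed

lemma drift_map_isolated_direction: "isolated_julia_limiting_direction drift_map 0"
  unfolding isolated_julia_limiting_direction_def
proof
  show "cis 0 isolated_in cis ` julia_limiting_directions drift_map"
    unfolding isolated_in_def
  proof (intro conjI exI)
    show "open {z. Re z > 0}" by (rule open_halfspace_Re_gt)
    have "Re (cis \<theta>) \<le> 0" if "\<theta> \<in> {pi / 2..3 * pi / 2}" for \<theta>
    proof -
      have "cos (\<theta> - pi) \<ge> 0" using that by (intro cos_ge_zero) auto
      then show ?thesis by (simp add: cos_diff)
    qed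
    then show "{z. Re z > 0} \<inter> cis ` julia_limiting_directions drift_map = {cis 0}"
      unfolding drift_map_limiting_directions by force
    show "cis 0 \<in> cis ` julia_limiting_directions drift_map" using zero_limiting_direction by blast
  qed
qed (rule zero_limiting_direction)

theorem theorem4:
  shows "(\<exists>f. transcendental_entire f \<and> growth_order f < \<infinity> \<and>
            (\<exists>\<theta>. isolated_julia_limiting_direction f \<theta>)) \<and>
         (\<exists>f. (\<forall>z. z \<notin> {0, 2 * of_real pi * \<i>, - (2 * of_real pi * \<i>)} \<longrightarrow>
                 f z = z - (1 - exp (- z)) / (z * (z\<^sup>2 + 4 * (of_real pi)\<^sup>2))) \<and>
            transcendental_entire f \<and> growth_order f < \<infinity> \<and>
            (\<exists>\<theta>. isolated_julia_limiting_direction f \<theta>) \<and>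
            julia_limiting_directions f = {pi / 2..3 * pi / 2} \<union> {0})"
proof -
  have formula: "\<forall>z. z \<notin> {0, 2 * of_real pi * \<i>, - (2 * of_real pi * \<i>)} \<longrightarrow>
       drift_map z = z - (1 - exp (- z)) / (z * (z\<^sup>2 + 4 * (of_real pi)\<^sup>2))"
    using drift_map_eq unfolding cubic_def by blast
  have iso: "\<exists>\<theta>. isolated_julia_limiting_direction drift_map \<theta>"
    using drift_map_isolated_direction by blast
  show ?thesis
    by (intro conjI exI[of _ drift_map] drift_map_transcendental drift_map_finite_order iso
        formula drift_map_limiting_directions)
qed

end
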